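(* Let $p>0$, $\alpha>0$ and $n\in\mathbb{N}$. The function $g(X) = \operatorname{Tr}\left(X^{-p}\right)$ is generalized self-concordant of order $\nu = 3$ with constant $$M_g=\frac{(p+2)\sqrt[4]{\alpha^{2p}n}}{\sqrt{p(p+1)}}$$ on $\mathcal{D}=\left\{X\in\mathbb{S}_{++}^n : 0 \prec X \preccurlyeq \alpha I \right\}$.
   Context: $\mathbb{S}_{++}^n$ is the set of symmetric positive definite $n\times n$ matrices, viewed inside the Euclidean space of symmetric $n\times n$ matrices with inner product $\langle U,V\rangle=\operatorname{Tr}(UV)$ and Frobenius norm; $\preccurlyeq$ is the Loewner order. Real powers of positive definite matrices are defined through the eigendecomposition. A three-times differentiable convex function $f$ is $(M_f,\nu)$-generalized self-concordant with order $\nu>0$ and constant $M_f\ge0$ (on a set of points) if for all points $x$ of the set and all directions $u,v$, $$\left|\langle\nabla^3 f(x)[v]u,u\rangle\right|\le M_f\,\|u\|_x^2\,\|v\|_x^{\nu-2}\,\|v\|_2^{3-\nu},$$ where $\|w\|_x=\langle\nabla^2 f(x)w,w\rangle^{1/2}$, $\nabla^3f(x)[v]=\lim_{\gamma\to0}\gamma^{-1}(\nabla^2f(x+\gamma v)-\nabla^2f(x))$, and $\|\cdot\|_2$ is the Euclidean norm of the ambient space. *)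

theory Defs
  imports "HOL-Analysis.Analysis"
begin

section \<open>The Euclidean space of real symmetric matrices\<close>

typedef (overloaded) 'n symmat = "{A :: real^'n^'n. transpose A = A}"
  morphisms mat_of Abs_symmat
  by (rule exI[of _ 0]) (simp add: transpose_def vec_eq_iff)

lemma transpose_mat_of [simp]: "transpose (mat_of X) = mat_of X"
  using mat_of[of X] by simp

lemma subspace_symmetric: "subspace {A :: real^'n^'n. transpose A = A}"
  by (auto simp: subspace_def transpose_def vec_eq_iff)

lemma mat_of_Abs: "transpose A = A \<Longrightarrow> mat_of (Abs_symmat A) = A"
  by (simp add: Abs_symmat_inverse)

lemma mat_of_eqI: "mat_of X = mat_of Y \<Longrightarrow> X = Y"
  by (simp add: mat_of_inject)

instantiation symmat :: (finite) real_vector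
begin

definition zero_symmat :: "'a symmat" where
  "zero_symmat = Abs_symmat 0"
definition plus_symmat :: "'a symmat \<Rightarrow> 'a symmat \<Rightarrow> 'a symmat" where
  "plus_symmat X Y = Abs_symmat (mat_of X + mat_of Y)"
definition minus_symmat :: "'a symmat \<Rightarrow> 'a symmat \<Rightarrow> 'a symmat" where
  "minus_symmat X Y = Abs_symmat (mat_of X - mat_of Y)"
definition uminus_symmat :: "'a symmat \<Rightarrow> 'a symmat" where
  "uminus_symmat X = Abs_symmat (- mat_of X)"
definition scaleR_symmat :: "real \<Rightarrow> 'a symmat \<Rightarrow> 'a symmat" where
  "scaleR_symmat c X = Abs_symmat (c *\<^sub>R mat_of X)"

lemma mat_of_zero [simp]: "mat_of (0 :: 'a symmat) = 0"
  unfolding zero_symmat_def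
  by (rule mat_of_Abs) (use subspace_0[OF subspace_symmetric] in simp)

lemma mat_of_plus [simp]: "mat_of (X + Y :: 'a symmat) = mat_of X + mat_of Y"
  unfolding plus_symmat_def
  by (rule mat_of_Abs) (use subspace_add[OF subspace_symmetric mat_of mat_of] in simp)

lemma mat_of_minus [simp]: "mat_of (X - Y :: 'a symmat) = mat_of X - mat_of Y"
  unfolding minus_symmat_def
  by (rule mat_of_Abs) (use subspace_diff[OF subspace_symmetric mat_of mat_of] in simp)

lemma mat_of_uminus [simp]: "mat_of (- X :: 'a symmat) = - mat_of X"
  unfolding uminus_symmat_def
  by (rule mat_of_Abs) (use subspace_neg[OF subspace_symmetric mat_of] in simp)

lemma mat_of_scaleR [simp]: "mat_of (c *\<^sub>R X :: 'a symmat) = c *\<^sub>R mat_of X"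
  unfolding scaleR_symmat_def
  by (rule mat_of_Abs) (use subspace_scale[OF subspace_symmetric mat_of] in simp)

instance
proof
  fix a b c :: "'a symmat" and r s :: real
  show "a + b + c = a + (b + c)" by (rule mat_of_eqI) simp
  show "a + b = b + a" by (rule mat_of_eqI) simp
  show "0 + a = a" by (rule mat_of_eqI) simp
  show "- a + a = 0" by (rule mat_of_eqI) simp
  show "a - b = a + - b" by (rule mat_of_eqI) simp
  show "r *\<^sub>R (a + b) = r *\<^sub>R a + r *\<^sub>R b"
    by (rule mat_of_eqI) (simp add: scaleR_add_right)
  show "(r + s) *\<^sub>R a = r *\<^sub>R a + s *\<^sub>R a"
    by (rule mat_of_eqI) (simp add: scaleR_add_left)
  show "r *\<^sub>R s *\<^sub>R a = (r * s) *\<^sub>R a" by (rule mat_of_eqI) simp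
  show "1 *\<^sub>R a = a" by (rule mat_of_eqI) simp
qed

end

lemma trace_mult_eq_inner:
  fixes A B :: "real^'n^'n"
  assumes "transpose A = A"
  shows "trace (A ** B) = inner A B"
proof -
  have "transpose A $ i $ k = A $ k $ i" for i k
    by (simp add: transpose_def)
  then have "A $ i $ k = A $ k $ i" for i k
    unfolding assms .
  then have "trace (A ** B) = (\<Sum>i\<in>UNIV. \<Sum>k\<in>UNIV. A $ k $ i * B $ k $ i)"
    unfolding trace_def matrix_matrix_mult_def by simp
  also have "\<dots> = inner A B"
    unfolding inner_vec_def inner_real_def by (rule sum.swap)
  finally show ?thesis .
qed

instantiation symmat :: (finite) real_inner
begin

definition inner_symmat :: "'a symmat \<Rightarrow> 'a symmat \<Rightarrow> real" where
  "inner_symmat U V = trace (mat_of U ** mat_of V)"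
definition norm_symmat :: "'a symmat \<Rightarrow> real" where
  "norm_symmat U = sqrt (inner U U)"
definition sgn_symmat :: "'a symmat \<Rightarrow> 'a symmat" where
  "sgn_symmat U = U /\<^sub>R norm U"
definition dist_symmat :: "'a symmat \<Rightarrow> 'a symmat \<Rightarrow> real" where
  "dist_symmat U V = norm (U - V)"
definition uniformity_symmat :: "('a symmat \<times> 'a symmat) filter" where
  "uniformity_symmat = (INF e\<in>{0<..}. principal {(x, y). dist x y < e})"
definition open_symmat :: "'a symmat set \<Rightarrow> bool" where
  "open_symmat S \<longleftrightarrow> (\<forall>x\<in>S. \<forall>\<^sub>F (x', y) in uniformity. x' = x \<longrightarrow> y \<in> S)"

lemma inner_symmat_eq: "inner U (V :: 'a symmat) = inner (mat_of U) (mat_of V)"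
  by (simp add: inner_symmat_def trace_mult_eq_inner)

instance
proof
  fix x y z :: "'a symmat" and r :: real and S :: "'a symmat set"
  show "dist x y = norm (x - y)" by (rule dist_symmat_def)
  show "sgn x = x /\<^sub>R norm x" by (rule sgn_symmat_def)
  show "uniformity = (INF e\<in>{0<..}. principal {(x :: 'a symmat, y). dist x y < e})"
    by (rule uniformity_symmat_def)
  show "open S \<longleftrightarrow> (\<forall>x\<in>S. \<forall>\<^sub>F (x', y) in uniformity. x' = x \<longrightarrow> y \<in> S)"
    by (rule open_symmat_def)
  show "inner x y = inner y x" by (simp add: inner_symmat_eq inner_commute)
  show "inner (x + y) z = inner x z + inner y z"
    by (simp add: inner_symmat_eq inner_add_left)
  show "inner (r *\<^sub>R x) y = r * inner x y" by (simp add: inner_symmat_eq)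
  show "0 \<le> inner x x" by (simp add: inner_symmat_eq)
  show "inner x x = 0 \<longleftrightarrow> x = 0"
    by (auto simp: inner_symmat_eq intro: mat_of_eqI)
  show "norm x = sqrt (inner x x)" by (rule norm_symmat_def)
qed

end

lemma norm_symmat_eq: "norm (U :: 'n::finite symmat) = norm (mat_of U)"
  by (simp add: norm_symmat_def inner_symmat_eq norm_eq_sqrt_inner)

lemma symmat_orthonormal_basis_exists:
  "\<exists>B :: 'n::finite symmat set. B \<noteq> {} \<and> finite B \<and>
     (\<forall>u\<in>B. \<forall>v\<in>B. inner u v = (if u = v then 1 else 0)) \<and>
     (\<forall>x. (\<forall>u\<in>B. inner x u = 0) \<longleftrightarrow> x = 0)"
proof -
  let ?S = "{A :: real^'n^'n. transpose A = A}"
  obtain C where C: "C \<subseteq> ?S" "pairwise orthogonal C" "\<And>x. x \<in> C \<Longrightarrow> norm x = 1"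
      "independent C" "span C = ?S"
    by (rule orthonormal_basis_subspace[OF subspace_symmetric]) (rule that)
  define B where "B = Abs_symmat ` C"
  have mB: "mat_of ` B = C"
    unfolding B_def image_image using C(1) by (subst image_cong[OF refl mat_of_Abs]) auto
  have fin: "finite B"
    unfolding B_def using C(4) independent_imp_finite by blast
  have orth: "inner u v = (if u = v then 1 else 0)" if "u \<in> B" "v \<in> B" for u v
  proof -
    have m: "mat_of u \<in> C" "mat_of v \<in> C" using that mB by auto
    show ?thesis
    proof (cases "u = v")
      case True
      then show ?thesis using C(3)[OF m(1)] by (simp add: inner_symmat_eq norm_eq_1)
    next
      case False
      then have "mat_of u \<noteq> mat_of v" using mat_of_eqI by blast
      then show ?thesis
        using C(2) m False by (simp add: inner_symmat_eq pairwise_def orthogonal_def)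
    qed
  qed
  have zero: "x = 0" if "\<forall>u\<in>B. inner x u = 0" for x
  proof -
    have "orthogonal (mat_of x) y" if "y \<in> C" for y
      using that \<open>\<forall>u\<in>B. inner x u = 0\<close> mB
      by (force simp: inner_symmat_eq orthogonal_def)
    moreover have "mat_of x \<in> span C" using C(5) mat_of[of x] by simp
    ultimately have "orthogonal (mat_of x) (mat_of x)"
      by (rule orthogonal_to_span[rotated])
    then show ?thesis by (auto simp: orthogonal_def intro: mat_of_eqI)
  qed
  have "B \<noteq> {}"
  proof
    assume "B = {}"
    then have "Abs_symmat (mat 1) = (0 :: 'n symmat)" using zero by blast
    then have "mat_of (Abs_symmat (mat 1)) = (0 :: real^'n^'n)" by simp
    then have "(mat 1 :: real^'n^'n) = 0" by (simp add: mat_of_Abs)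
    then have "(mat 1 :: real^'n^'n) $ i $ i = 0" for i by simp
    then show False by (simp add: mat_def)
  qed
  then show ?thesis using fin orth zero
    by (intro exI[of _ B] conjI ballI allI iffI) simp_all
qed

instantiation symmat :: (finite) euclidean_space
begin

definition Basis_symmat :: "'a symmat set" where
  "Basis_symmat = (SOME B. B \<noteq> {} \<and> finite B \<and>
     (\<forall>u\<in>B. \<forall>v\<in>B. inner u v = (if u = v then 1 else 0)) \<and>
     (\<forall>x. (\<forall>u\<in>B. inner x u = 0) \<longleftrightarrow> x = 0))"

instance
proof
  have B: "(Basis :: 'a symmat set) \<noteq> {} \<and> finite (Basis :: 'a symmat set) \<and>
     (\<forall>u\<in>Basis. \<forall>v\<in>Basis. inner u (v :: 'a symmat) = (if u = v then 1 else 0)) \<and>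
     (\<forall>x :: 'a symmat. (\<forall>u\<in>Basis. inner x u = 0) \<longleftrightarrow> x = 0)"
    unfolding Basis_symmat_def by (rule someI_ex[OF symmat_orthonormal_basis_exists])
  show "(Basis :: 'a symmat set) \<noteq> {}" "finite (Basis :: 'a symmat set)"
    using B by blast+
  show "inner u v = (if u = v then 1 else 0)" if "u \<in> Basis" "v \<in> Basis" for u v :: "'a symmat"
    using B that by blast
  show "(\<forall>u\<in>Basis. inner x u = 0) \<longleftrightarrow> x = 0" for x :: "'a symmat"
    using B by blast
qed

end

definition id_symmat :: "'n::finite symmat" where
  "id_symmat = Abs_symmat (mat 1)"

lemma mat_of_id_symmat [simp]: "mat_of id_symmat = mat 1"
  by (simp add: id_symmat_def mat_of_Abs)

section \<open>Loewner order and positive definite matrices\<close>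

definition loewner_le :: "'n::finite symmat \<Rightarrow> 'n symmat \<Rightarrow> bool"  (infix \<open>\<preceq>\<^sub>L\<close> 50) where
  "X \<preceq>\<^sub>L Y \<longleftrightarrow> (\<forall>v :: real^'n. 0 \<le> inner v (mat_of (Y - X) *v v))"

definition loewner_less :: "'n::finite symmat \<Rightarrow> 'n symmat \<Rightarrow> bool"  (infix \<open>\<prec>\<^sub>L\<close> 50) where
  "X \<prec>\<^sub>L Y \<longleftrightarrow> (\<forall>v :: real^'n. v \<noteq> 0 \<longrightarrow> 0 < inner v (mat_of (Y - X) *v v))"

definition pos_def_mats :: "'n::finite symmat set" where
  "pos_def_mats = {X. 0 \<prec>\<^sub>L X}"

section \<open>Real matrix powers\<close>

definition diag_mat :: "real^'n \<Rightarrow> real^'n^'n" where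
  "diag_mat d = (\<chi> i j. if i = j then d $ i else 0)"

definition mat_powr :: "'n::finite symmat \<Rightarrow> real \<Rightarrow> real^'n^'n" where
  "mat_powr X r = (THE Y. \<exists>(Q :: real^'n^'n) (d :: real^'n). orthogonal_matrix Q \<and>
     mat_of X = Q ** diag_mat d ** transpose Q \<and>
     Y = Q ** diag_mat (\<chi> i. (d $ i) powr r) ** transpose Q)"

text \<open>The value does not depend on the chosen eigendecomposition.\<close>

lemma eigendecomposition_powr_unique:
  fixes Q P :: "real^'n::finite^'n" and d e :: "real^'n"
  assumes Q: "orthogonal_matrix Q" and P: "orthogonal_matrix P"
    and eq: "Q ** diag_mat d ** transpose Q = P ** diag_mat e ** transpose P"
  shows "Q ** diag_mat (\<chi> i. (d $ i) powr r) ** transpose Q =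
         P ** diag_mat (\<chi> i. (e $ i) powr r) ** transpose P"
proof -
  define R where "R = transpose P ** Q"
  have dl: "(diag_mat a ** M) $ i $ j = a $ i * M $ i $ j"
    for a :: "real^'n" and M :: "real^'n^'n" and i j
    by (simp add: diag_mat_def matrix_matrix_mult_def if_distrib[where f="\<lambda>x. x * _"]
        cong: if_cong)
  have dr: "(M ** diag_mat a) $ i $ j = M $ i $ j * a $ j"
    for a :: "real^'n" and M :: "real^'n^'n" and i j
    by (simp add: diag_mat_def matrix_matrix_mult_def if_distrib[where f="\<lambda>x. _ * x"]
        cong: if_cong)
  have QQ: "transpose Q ** Q = mat 1" "Q ** transpose Q = mat 1"
    and PP: "transpose P ** P = mat 1" "P ** transpose P = mat 1"
    using Q P by (auto simp: orthogonal_matrix_def)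
  have "R ** diag_mat d = transpose P ** (Q ** diag_mat d ** transpose Q) ** Q"
    unfolding R_def by (simp add: matrix_mul_assoc[symmetric] QQ)
  also have "\<dots> = diag_mat e ** R"
    unfolding eq R_def by (simp add: matrix_mul_assoc PP)
  finally have "R $ i $ j * d $ j = e $ i * R $ i $ j" for i j
    by (metis dl dr)
  then have "R $ i $ j * (d $ j) powr r = (e $ i) powr r * R $ i $ j" for i j
    by (metis mult.commute mult_cancel_left mult_zero_left)
  then have *: "R ** diag_mat (\<chi> i. (d $ i) powr r) = diag_mat (\<chi> i. (e $ i) powr r) ** R"
    by (simp add: vec_eq_iff dl dr)
  have "Q = P ** R" unfolding R_def by (simp add: matrix_mul_assoc PP)
  then have "Q ** diag_mat (\<chi> i. (d $ i) powr r) ** transpose Q =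
      P ** (R ** diag_mat (\<chi> i. (d $ i) powr r)) ** transpose Q"
    by (simp add: matrix_mul_assoc)
  also have "\<dots> = P ** diag_mat (\<chi> i. (e $ i) powr r) ** (R ** transpose Q)"
    unfolding * by (simp add: matrix_mul_assoc)
  also have "R ** transpose Q = transpose P"
    unfolding R_def by (simp add: matrix_mul_assoc[symmetric] QQ)
  finally show ?thesis .
qed

section \<open>Generalized self-concordance\<close>

definition grad :: "('a::real_inner \<Rightarrow> real) \<Rightarrow> 'a \<Rightarrow> 'a" where
  "grad f x = (THE D. GDERIV f x :> D)"

definition hessian :: "('a::real_inner \<Rightarrow> real) \<Rightarrow> 'a \<Rightarrow> 'a \<Rightarrow>\<^sub>L 'a" where
  "hessian f x = (THE H. (grad f has_derivative blinfun_apply H) (at x))"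

definition third_deriv :: "('a::real_inner \<Rightarrow> real) \<Rightarrow> 'a \<Rightarrow> 'a \<Rightarrow> 'a \<Rightarrow>\<^sub>L 'a" where
  "third_deriv f x v =
     Lim (at 0) (\<lambda>\<gamma>::real. (hessian f (x + \<gamma> *\<^sub>R v) - hessian f x) /\<^sub>R \<gamma>)"

definition three_times_differentiable_on :: "('a::real_inner \<Rightarrow> real) \<Rightarrow> 'a set \<Rightarrow> bool" where
  "three_times_differentiable_on f S \<longleftrightarrow>
     (\<forall>x\<in>S. f differentiable (at x) \<and> grad f differentiable (at x) \<and>
            hessian f differentiable (at x))"

definition local_norm :: "('a::real_inner \<Rightarrow> real) \<Rightarrow> 'a \<Rightarrow> 'a \<Rightarrow> real" where
  "local_norm f x w = sqrt (inner (blinfun_apply (hessian f x) w) w)"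

text \<open>\<open>0 powr 0 = 0\<close> in the library, whereas the definition below needs \<open>0\<^sup>0 = 1\<close>.\<close>

definition pow_real :: "real \<Rightarrow> real \<Rightarrow> real" where
  "pow_real t a = (if a = 0 then 1 else t powr a)"

text \<open>\<open>S\<close> is the open convex domain on which \<open>f\<close> is differentiated; the inequality is
  required at the points of \<open>A\<close>, which need not be open.\<close>

definition generalized_self_concordant ::
    "('a::real_inner \<Rightarrow> real) \<Rightarrow> 'a set \<Rightarrow> 'a set \<Rightarrow> real \<Rightarrow> real \<Rightarrow> bool" where
  "generalized_self_concordant f S A M \<nu> \<longleftrightarrow>
     0 < \<nu> \<and> 0 \<le> M \<and> open S \<and> A \<subseteq> S \<and> convex_on S f \<and> three_times_differentiable_on f S \<and>
     (\<forall>x\<in>A. \<forall>u v.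
        \<bar>inner (blinfun_apply (third_deriv f x v) u) u\<bar> \<le>
          M * (local_norm f x u)\<^sup>2 * pow_real (local_norm f x v) (\<nu> - 2) * pow_real (norm v) (3 - \<nu>))"

end

theory Submission
  imports Defs
begin

text \<open>In an eigenbasis of \<open>X\<close> with eigenvalues \<open>\<lambda>\<close>, the derivatives of \<open>g(X) = Tr (X ^ - p)\<close> are
  \<open>D\<^sup>2 g[U, U] = (\<Sum>i j. K2 i j * u i j ^ 2)\<close> and \<open>D\<^sup>3 g[V, U, U] = - (\<Sum>i j l. K3 i j l * v i j * u j l * u l i)\<close>,
  where the kernels are divided differences of \<open>x ^ (- p - 1)\<close>. With \<open>\<mu> = 1 / \<lambda>\<close> one gets
  \<open>K2 i j = p (p + 1) \<mu> i \<mu> j G i j\<close> and \<open>K3 i j l = p (p + 1) (p + 2) \<mu> i \<mu> j \<mu> l H i j l\<close>, where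
  \<open>G\<close> and \<open>H\<close> are the averages of \<open>x ^ p\<close> over the segment and the triangle spanned by the
  corresponding \<open>\<mu>\<close>. If \<open>\<mu> i\<close> is the least of the three and \<open>\<mu> \<ge> 1 / \<alpha>\<close>, then \<open>H i j l \<le> G j l\<close> and
  \<open>H i j l \<le> \<alpha> ^ p G i j G i l\<close>, so \<open>K3\<^sup>2\<close> is pointwise bounded by a multiple of
  \<open>K2 i j * K2 j l * K2 l i\<close>; weighting the entries of \<open>U\<close> and \<open>V\<close> by \<open>sqrt K2\<close>, the inequality
  becomes submultiplicativity of the Frobenius norm. Smoothness and the two formulas come from the
  binomial series of \<open>g\<close> around a multiple of the identity.\<close>

section \<open>Gradient, Hessian and third derivative\<close>

text \<open>Eigenvectors need not vary differentiably where eigenvalues meet, so nothing is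
  differentiated in an eigenbasis. Matrix powers are differentiated termwise as noncommutative
  polynomials, and only the result at one fixed X is rotated into an eigenbasis. There the divided
  differences of x ^ k appear, which are polynomials and keep their meaning at equal eigenvalues.
  The inequality between the kernels is proved for distinct eigenvalues and extended by continuity.
  Expanding in I - X / \<beta> with \<beta> > norm X puts the eigenvalues of the variable in [0, 1),
  where the series has nonnegative coefficients; positivity of both kernels, hence convexity,
  follows at once. Of the two bounds on H, one uses the side opposite to the least \<mu>, the other
  the two sides meeting there; their product contains each side once, the shape that a weighting by
  sqrt K2 requires. H has degree p in \<mu> and the product of two G has degree 2 p: the bound \<mu>
  \<ge> 1 / \<alpha> pays for this difference and produces \<alpha> ^ p.\<close>

lemma grad_eqI:
  fixes f :: "'a::real_inner \<Rightarrow> real"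
  assumes "GDERIV f x :> D"
  shows "grad f x = D"
  unfolding grad_def
proof (rule the_equality[where P="\<lambda>D. GDERIV f x :> D", OF assms])
  fix D' assume "GDERIV f x :> D'"
  then have "(\<lambda>h. inner h D') = (\<lambda>h. inner h D)"
    using assms has_derivative_unique unfolding gderiv_def by blast
  then show "D' = D"
    by (metis inner_commute inner_eq_zero_iff inner_diff_right right_minus_eq)
qed

lemma hessian_eqI:
  fixes f :: "'a::real_inner \<Rightarrow> real"
  assumes "(grad f has_derivative blinfun_apply H) (at x)"
  shows "hessian f x = H"
  unfolding hessian_def
proof (rule the_equality[where P="\<lambda>H. (grad f has_derivative blinfun_apply H) (at x)", OF assms])
  fix H' assume "(grad f has_derivative blinfun_apply H') (at x)"
  then show "H' = H"
    using assms has_derivative_unique blinfun_apply_inject by blast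
qed

text \<open>In finite dimension an operator is a linear combination of fixed elementary ones, with
  coefficients read off from its values on the basis; so differentiability at every argument
  \<open>u\<close> gives differentiability in operator norm.\<close>

lemma has_derivative_blinfunI:
  fixes B :: "'b::real_normed_vector \<Rightarrow> 'a::euclidean_space \<Rightarrow>\<^sub>L 'c::euclidean_space"
  assumes "\<And>u. ((\<lambda>x. blinfun_apply (B x) u) has_derivative (\<lambda>v. T v u)) (at x)"
  shows "(B has_derivative (\<lambda>v. blinfun_of_matrix (\<lambda>i j. T v j \<bullet> i))) (at x)"
proof -
  have eq: "blinfun_of_matrix a = (\<Sum>i\<in>Basis. \<Sum>j\<in>Basis. a i j *\<^sub>R blinfun_of_matrix (\<lambda>i' j'. if i' = i \<and> j' = j then 1 else 0))"
    for a :: "'c \<Rightarrow> 'a \<Rightarrow> real"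
  proof (rule blinfun_eqI)
    fix y
    have "(\<Sum>i'\<in>Basis. \<Sum>j'\<in>Basis. ((y \<bullet> j') * (if i' = i \<and> j' = j then 1 else 0)) *\<^sub>R i') = (y \<bullet> j) *\<^sub>R i"
      if "i \<in> Basis" "j \<in> Basis" for i :: 'c and j :: 'a
    proof -
      have "(\<Sum>i'\<in>Basis. \<Sum>j'\<in>Basis. ((y \<bullet> j') * (if i' = i \<and> j' = j then 1 else 0)) *\<^sub>R i')
        = (\<Sum>i'\<in>Basis. if i' = i then (\<Sum>j'\<in>Basis. if j' = j then (y \<bullet> j') *\<^sub>R i' else 0) else 0)"
        by (intro sum.cong refl)
          (simp add: if_distrib[where f="\<lambda>x. _ * x"] if_distrib[where f="\<lambda>x. x *\<^sub>R _"] cong: if_cong)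
      then show ?thesis using that by simp
    qed
    then show "blinfun_of_matrix a y = (\<Sum>i\<in>Basis. \<Sum>j\<in>Basis. a i j *\<^sub>R blinfun_of_matrix (\<lambda>i' j'. if i' = i \<and> j' = j then 1 else 0)) y"
      by (simp add: blinfun_of_matrix_apply blinfun.sum_left blinfun.scaleR_left mult.commute)
  qed
  have B: "B = (\<lambda>x. blinfun_of_matrix (\<lambda>i j. blinfun_apply (B x) j \<bullet> i))"
    by (simp add: blinfun_of_matrix_works)
  show ?thesis
    apply (subst B)
    apply (subst (1 2) eq)
    by (intro has_derivative_sum has_derivative_scaleR_left has_derivative_inner_left assms)
qed

lemma third_deriv_eqI:
  fixes f :: "'a::euclidean_space \<Rightarrow> real"
  assumes "(hessian f has_derivative L) (at x)"
  shows "third_deriv f x v = L v"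
  unfolding third_deriv_def
proof (rule tendsto_Lim)
  interpret L: bounded_linear L using assms by (rule has_derivative_bounded_linear)
  have "((\<lambda>\<gamma>::real. hessian f (x + \<gamma> *\<^sub>R v)) has_derivative (\<lambda>\<gamma>. L (\<gamma> *\<^sub>R v))) (at 0)"
    by (rule has_derivative_compose[of "\<lambda>\<gamma>. x + \<gamma> *\<^sub>R v" _ _ _ "hessian f", simplified])
      (use assms in \<open>auto intro!: derivative_eq_intros\<close>)
  then have "((\<lambda>\<gamma>. norm (hessian f (x + \<gamma> *\<^sub>R v) - hessian f x - \<gamma> *\<^sub>R L v) / norm \<gamma>) \<longlongrightarrow> 0) (at 0)"
    by (simp add: has_derivative_at L.scaleR)
  moreover have "norm (hessian f (x + \<gamma> *\<^sub>R v) - hessian f x - \<gamma> *\<^sub>R L v) / norm \<gamma>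
      = norm ((hessian f (x + \<gamma> *\<^sub>R v) - hessian f x) /\<^sub>R \<gamma> - L v)" if "\<gamma> \<noteq> 0" for \<gamma>
  proof -
    have "(hessian f (x + \<gamma> *\<^sub>R v) - hessian f x) /\<^sub>R \<gamma> - L v
        = (hessian f (x + \<gamma> *\<^sub>R v) - hessian f x - \<gamma> *\<^sub>R L v) /\<^sub>R \<gamma>"
      using that by (simp add: scaleR_diff_right)
    then show ?thesis by (simp add: divide_inverse_commute)
  qed
  ultimately have "((\<lambda>\<gamma>. norm ((hessian f (x + \<gamma> *\<^sub>R v) - hessian f x) /\<^sub>R \<gamma> - L v)) \<longlongrightarrow> 0) (at 0)"
    by (elim Lim_transform_eventually) (simp add: eventually_at_filter)
  then show "((\<lambda>\<gamma>. (hessian f (x + \<gamma> *\<^sub>R v) - hessian f x) /\<^sub>R \<gamma>) \<longlongrightarrow> L v) (at 0)"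
    using LIM_zero_iff tendsto_norm_zero_iff by blast
qed simp

text \<open>Connects the \<open>THE\<close> and \<open>Lim\<close> definitions with explicit
  formulas. These have to hold on a neighbourhood, because \<open>grad f\<close> and
  \<open>hessian f\<close> are differentiated again as functions of the point.\<close>

lemma third_order_calculus:
  fixes f :: "'a::euclidean_space \<Rightarrow> real"
  assumes N: "open N" "x \<in> N"
    and G: "\<And>y. y \<in> N \<Longrightarrow> GDERIV f y :> G y"
    and H: "\<And>y. y \<in> N \<Longrightarrow> (G has_derivative H y) (at y)"
    and T: "\<And>y u. y \<in> N \<Longrightarrow> ((\<lambda>z. H z u) has_derivative (\<lambda>v. T y v u)) (at y)"
  shows "GDERIV f x :> grad f x"
    and "(grad f has_derivative blinfun_apply (hessian f x)) (at x)"
    and "hessian f differentiable (at x)"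
    and "blinfun_apply (hessian f x) u = H x u"
    and "blinfun_apply (third_deriv f x v) u = T x v u"
proof -
  have gr: "grad f y = G y" if "y \<in> N" for y using G[OF that] by (rule grad_eqI)
  show "GDERIV f x :> grad f x" using G gr N by simp
  have he: "(grad f has_derivative H y) (at y)" if "y \<in> N" for y
    by (rule has_derivative_transform_within_open[OF H[OF that] N(1) that]) (simp add: gr)
  have he': "hessian f y = Blinfun (H y)" if "y \<in> N" for y
    by (rule hessian_eqI)
      (use he[OF that] in \<open>simp add: bounded_linear_Blinfun_apply has_derivative_bounded_linear\<close>)
  have ha: "blinfun_apply (hessian f y) = H y" if "y \<in> N" for y
    using he[OF that] he'[OF that]
    by (simp add: bounded_linear_Blinfun_apply has_derivative_bounded_linear)
  show "(grad f has_derivative blinfun_apply (hessian f x)) (at x)" using ha he N by simp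
  show "blinfun_apply (hessian f x) u = H x u" using ha N by simp
  have t: "((\<lambda>z. blinfun_apply (hessian f z) u) has_derivative (\<lambda>v. T x v u)) (at x)" for u
    by (rule has_derivative_transform_within_open[OF T[OF N(2)] N]) (simp add: ha)
  note d = has_derivative_blinfunI[OF t]
  show "hessian f differentiable (at x)" using d by (rule differentiableI)
  have "third_deriv f x v = blinfun_of_matrix (\<lambda>i j. T x v j \<bullet> i)"
    using d by (rule third_deriv_eqI)
  \<comment> \<open>Linearity of \<open>T x v u\<close> in \<open>u\<close> is not assumed;
    uniqueness of the derivative identifies it with the operator built from its values on the
    basis.\<close>
  moreover have "((\<lambda>z. blinfun_apply (hessian f z) u) has_derivative
      (\<lambda>v. blinfun_apply (blinfun_of_matrix (\<lambda>i j. T x v j \<bullet> i)) u)) (at x)"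
    by (rule bounded_linear.has_derivative[OF blinfun.bounded_linear_left d])
  then have "(\<lambda>v. blinfun_apply (blinfun_of_matrix (\<lambda>i j. T x v j \<bullet> i)) u) = (\<lambda>v. T x v u)"
    using t has_derivative_unique by blast
  ultimately show "blinfun_apply (third_deriv f x v) u = T x v u" by metis
qed

section \<open>Diagonalisation of symmetric matrices\<close>

lemma inner_matrix_vector_mult_right: "x \<bullet> (A *v y) = (transpose A *v x) \<bullet> (y :: real^'n::finite)"
  by (simp add: dot_lmul_matrix)

lemma inner_symmetric_matrix:
  fixes A :: "real^'n^'n"
  assumes "transpose A = A"
  shows "x \<bullet> (A *v y) = (A *v x) \<bullet> y"
  using inner_matrix_vector_mult_right[of x A y] unfolding assms .

text \<open>A maximiser x of the Rayleigh quotient on the unit sphere of S is an eigenvector: the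
  residual w = A x - l x lies in S and is orthogonal to x, and if it were nonzero, moving from x
  towards w would raise the quotient at first order.\<close>

lemma invariant_subspace_eigenvector:
  fixes A :: "real^'n::finite^'n"
  assumes A: "transpose A = A" and S: "subspace S" "\<And>x. x \<in> S \<Longrightarrow> A *v x \<in> S" "S \<noteq> {0}"
  obtains x l where "x \<in> S" "norm x = 1" "A *v x = l *\<^sub>R x"
proof -
  let ?K = "S \<inter> sphere 0 1"
  obtain y where y: "y \<in> S" "y \<noteq> 0" using S(1,3) subspace_0 by blast
  then have "y /\<^sub>R norm y \<in> ?K" using S(1) by (simp add: subspace_scale)
  then have ne: "?K \<noteq> {}" by blast
  have co: "compact ?K" by (simp add: closed_Int_compact closed_subspace S(1))
  have "continuous_on ?K (\<lambda>x. x \<bullet> (A *v x))"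
    by (intro continuous_on_inner continuous_on_id linear_continuous_on matrix_vector_mul_bounded_linear)
  from continuous_attains_sup[OF co ne this] obtain x
    where x: "x \<in> ?K" and mx: "\<And>z. z \<in> ?K \<Longrightarrow> z \<bullet> (A *v z) \<le> x \<bullet> (A *v x)" by blast
  define l where "l = x \<bullet> (A *v x)"
  have xS: "x \<in> S" and nx: "norm x = 1" using x by auto
  have le: "z \<bullet> (A *v z) \<le> l * (z \<bullet> z)" if z: "z \<in> S" for z
  proof (cases "z = 0")
    case False
    have "z /\<^sub>R norm z \<in> ?K" using False z S(1) by (simp add: subspace_scale)
    from mx[OF this] have "(z \<bullet> (A *v z)) / (norm z)\<^sup>2 \<le> l"
      by (simp add: l_def matrix_vector_mult_scaleR power2_eq_square divide_simps)
    then show ?thesis using False by (simp add: divide_simps power2_norm_eq_inner)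
  qed simp
  define w where "w = A *v x - l *\<^sub>R x"
  have wS: "w \<in> S" unfolding w_def using S(1,2) xS by (simp add: subspace_diff subspace_scale)
  have "x \<bullet> x = 1" using nx by (simp add: norm_eq_1)
  then have xw: "x \<bullet> w = 0" by (simp add: w_def inner_diff_right l_def)
  have Axw: "(A *v x) \<bullet> w = w \<bullet> w"
    using xw by (simp add: w_def inner_diff_left inner_diff_right inner_commute algebra_simps)
  have "w = 0"
  proof (rule ccontr)
    assume "w \<noteq> 0"
    then have ww: "w \<bullet> w > 0" by simp
    define c where "c = w \<bullet> (A *v w) - l * (w \<bullet> w)"
    have q: "2 * t * (w \<bullet> w) + t\<^sup>2 * c \<le> 0" for t
    proof -
      have "x + t *\<^sub>R w \<in> S" using S(1) xS wS by (simp add: subspace_add subspace_scale)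
      from le[OF this] show ?thesis
        using xw \<open>x \<bullet> x = 1\<close> Axw inner_symmetric_matrix[OF A, of x w]
        by (simp add: c_def matrix_vector_right_distrib matrix_vector_mult_scaleR inner_add_left inner_add_right
            l_def[symmetric] inner_commute algebra_simps power2_eq_square)
    qed
    \<comment> \<open>Small enough that the quadratic term cannot outweigh the linear one.\<close>
    define t where "t = (w \<bullet> w) / (\<bar>c\<bar> + 1)"
    have t: "t > 0" using ww by (simp add: t_def)
    have "t * \<bar>c\<bar> \<le> w \<bullet> w" unfolding t_def using ww by (simp add: divide_simps mult_left_mono)
    then have "- (w \<bullet> w) \<le> t * c" using t by (smt (verit) mult_left_mono mult_minus_right abs_ge_minus_self)
    then have "t * (2 * (w \<bullet> w) + t * c) > 0" using t ww by (intro mult_pos_pos) linarith+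
    with q[of t] show False by (simp add: algebra_simps power2_eq_square)
  qed
  then have "A *v x = l *\<^sub>R x" by (simp add: w_def)
  with xS nx that show thesis by blast
qed

text \<open>Induction on the dimension: by symmetry of A, the orthogonal complement of an
  eigenvector inside S is again invariant.\<close>

lemma eigenbasis_invariant_subspace:
  fixes A :: "real^'n::finite^'n"
  assumes A: "transpose A = A"
  shows "subspace S \<Longrightarrow> (\<And>x. x \<in> S \<Longrightarrow> A *v x \<in> S) \<Longrightarrow>
    \<exists>B. B \<subseteq> S \<and> span B = S \<and> pairwise orthogonal B \<and> (\<forall>x\<in>B. norm x = 1 \<and> (\<exists>l. A *v x = l *\<^sub>R x))"
proof (induction "dim S" arbitrary: S rule: less_induct)
  case less
  show ?case
  proof (cases "S = {0}")
    case True
    then show ?thesis by (intro exI[of _ "{}"]) auto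
  next
    case False
    obtain x l where x: "x \<in> S" "norm x = 1" "A *v x = l *\<^sub>R x"
      using invariant_subspace_eigenvector[OF A less.prems False] by blast
    define S' where "S' = S \<inter> {y. x \<bullet> y = 0}"
    have xx: "x \<bullet> x = 1" using x(2) by (simp add: norm_eq_1)
    have sub: "subspace S'" unfolding S'_def
      by (intro subspace_inter less.prems subspace_hyperplane)
    have inv: "A *v y \<in> S'" if "y \<in> S'" for y
      using that less.prems(2) inner_symmetric_matrix[OF A, of x y] x(3) by (simp add: S'_def)
    have "x \<notin> S'" using xx by (simp add: S'_def)
    moreover have "S' \<subseteq> S" by (auto simp: S'_def)
    ultimately have "S' \<subset> S" using x(1) by blast
    then have "dim S' < dim S"
      using dim_psubset sub less.prems(1) by (metis span_eq_iff)
    from less.hyps[OF this sub inv] obtain B where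
      B: "B \<subseteq> S'" "span B = S'" "pairwise orthogonal B" "\<forall>x\<in>B. norm x = 1 \<and> (\<exists>l. A *v x = l *\<^sub>R x)"
      by blast
    have "S \<subseteq> span (insert x B)"
    proof
      fix y assume y: "y \<in> S"
      have "y - (x \<bullet> y) *\<^sub>R x \<in> S'"
        using y x(1) less.prems(1) xx by (simp add: S'_def subspace_diff subspace_scale inner_diff_right)
      then show "y \<in> span (insert x B)" using B(2) by (auto simp: span_insert)
    qed
    moreover have "insert x B \<subseteq> S" using x B(1) by (auto simp: S'_def)
    then have "span (insert x B) \<subseteq> S" using less.prems(1) by (rule span_minimal)
    moreover have "pairwise orthogonal (insert x B)"
      using B(1,3) by (auto simp: pairwise_insert S'_def orthogonal_def inner_commute)
    ultimately show ?thesis using B(4) x(2,3) \<open>insert x B \<subseteq> S\<close>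
      by (intro exI[of _ "insert x B"]) auto
  qed
qed

theorem symmetric_matrix_eigendecomposition:
  fixes A :: "real^'n::finite^'n"
  assumes A: "transpose A = A"
  obtains Q d where "orthogonal_matrix Q" "A = Q ** diag_mat d ** transpose Q"
proof -
  obtain B where B: "span B = (UNIV :: (real^'n) set)" "pairwise orthogonal B"
      "\<And>x. x \<in> B \<Longrightarrow> norm x = 1" "\<And>x. x \<in> B \<Longrightarrow> \<exists>l. A *v x = l *\<^sub>R x"
    using eigenbasis_invariant_subspace[OF A, of UNIV] by auto
  have "0 \<notin> B" using B(3) by force
  then have ind: "independent B" using B(2) pairwise_orthogonal_independent by blast
  have "card B = CARD('n)"
    using basis_card_eq_dim[of B UNIV] ind B(1) by (simp add: dim_UNIV)
  moreover have "finite B" using ind independent_imp_finite by blast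
  ultimately obtain q where q: "bij_betw q (UNIV :: 'n set) B"
    using finite_same_card_bij[of "UNIV :: 'n set" B] by auto
  obtain d where d: "\<And>x. x \<in> B \<Longrightarrow> A *v x = d x *\<^sub>R x" using B(4) by metis
  have qB: "q i \<in> B" for i using q by (auto simp: bij_betw_def)
  have orth: "q i \<bullet> q j = (if i = j then 1 else 0)" for i j
  proof (cases "i = j")
    case True then show ?thesis using B(3)[OF qB] by (simp add: norm_eq_1)
  next
    case False
    then have "q i \<noteq> q j" using q by (auto simp: bij_betw_def inj_on_def)
    then show ?thesis using False B(2) qB by (auto simp: pairwise_def orthogonal_def)
  qed
  define Q :: "real^'n^'n" where "Q = (\<chi> i j. q j $ i)"
  have "transpose Q ** Q = mat 1"
    using orth by (simp add: Q_def transpose_def matrix_matrix_mult_def mat_def inner_vec_def vec_eq_iff)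
  then have Q: "orthogonal_matrix Q" by (simp add: orthogonal_matrix)
  have "A ** Q = Q ** diag_mat (\<chi> j. d (q j))"
  proof -
    have "(A *v q j) $ i = d (q j) * q j $ i" for i j using d[OF qB] by simp
    then show ?thesis
      by (simp add: vec_eq_iff Q_def matrix_matrix_mult_def matrix_vector_mult_def diag_mat_def
          if_distrib[where f="\<lambda>x. _ * x"] mult.commute cong: if_cong)
  qed
  then have "A ** Q ** transpose Q = Q ** diag_mat (\<chi> j. d (q j)) ** transpose Q" by simp
  then have "A = Q ** diag_mat (\<chi> j. d (q j)) ** transpose Q"
    using Q by (simp add: matrix_mul_assoc[symmetric] orthogonal_matrix_def)
  with Q that show thesis by blast
qed

section \<open>Power series of matrices\<close>

lemma norm_matrix_sq: "(norm (A :: real^'n::finite^'m::finite))\<^sup>2 = (\<Sum>i\<in>UNIV. \<Sum>j\<in>UNIV. (A $ i $ j)\<^sup>2)"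
  unfolding power2_norm_eq_inner by (simp add: inner_vec_def power2_eq_square)

lemma norm_transpose: "norm (transpose A) = norm (A :: real^'n::finite^'m::finite)"
proof -
  have "(norm (transpose A))\<^sup>2 = (norm A)\<^sup>2"
    unfolding norm_matrix_sq by (simp add: transpose_def) (rule sum.swap)
  then show ?thesis by simp
qed

lemma norm_matrix_mult_le:
  fixes A :: "real^'n::finite^'m::finite" and B :: "real^'k::finite^'n"
  shows "norm (A ** B) \<le> norm A * norm B"
proof -
  have "((A ** B) $ i $ j)\<^sup>2 \<le> (norm (A $ i))\<^sup>2 * (norm (transpose B $ j))\<^sup>2" for i j
  proof -
    have "(A ** B) $ i $ j = A $ i \<bullet> transpose B $ j"
      by (simp add: matrix_matrix_mult_def inner_vec_def transpose_def)
    then show ?thesis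
      by (metis Cauchy_Schwarz_ineq power2_norm_eq_inner)
  qed
  then have "(norm (A ** B))\<^sup>2 \<le> (\<Sum>i\<in>UNIV. \<Sum>j\<in>UNIV. (norm (A $ i))\<^sup>2 * (norm (transpose B $ j))\<^sup>2)"
    unfolding norm_matrix_sq by (intro sum_mono)
  also have "\<dots> = (\<Sum>i\<in>UNIV. (norm (A $ i))\<^sup>2) * (\<Sum>j\<in>UNIV. (norm (transpose B $ j))\<^sup>2)"
    by (simp add: sum_product)
  also have "\<dots> = (norm A)\<^sup>2 * (norm (transpose B))\<^sup>2"
    unfolding power2_norm_eq_inner by (simp add: inner_vec_def)
  also have "\<dots> = (norm A * norm B)\<^sup>2"
    by (simp add: norm_transpose power_mult_distrib)
  finally show ?thesis by (rule power2_le_imp_le) simp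
qed

lemma bounded_bilinear_matrix_mult:
  "bounded_bilinear ((**) :: real^'n::finite^'m::finite \<Rightarrow> real^'k::finite^'n \<Rightarrow> real^'k^'m)"
proof
  show "\<exists>K. \<forall>(A :: real^'n^'m) (B :: real^'k^'n). norm (A ** B) \<le> norm A * norm B * K"
    by (intro exI[of _ 1]) (simp add: norm_matrix_mult_le)
qed (auto simp: matrix_matrix_mult_def vec_eq_iff sum.distrib sum_distrib_left algebra_simps)

interpretation matrix_mult: bounded_bilinear
  "(**) :: real^'n::finite^'m::finite \<Rightarrow> real^'k::finite^'n \<Rightarrow> real^'k^'m"
  by (rule bounded_bilinear_matrix_mult)

primrec mat_power :: "real^'n::finite^'n \<Rightarrow> nat \<Rightarrow> real^'n^'n" where
  "mat_power A 0 = mat 1"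
| "mat_power A (Suc k) = A ** mat_power A k"

text \<open>The recursions are the Leibniz rule for the derivatives of the power map at \<open>A\<close>, of first
  order in direction \<open>U\<close> and of second order in directions \<open>V\<close> and \<open>U\<close>.\<close>

primrec dpower :: "real^'n::finite^'n \<Rightarrow> real^'n^'n \<Rightarrow> nat \<Rightarrow> real^'n^'n" where
  "dpower A U 0 = 0"
| "dpower A U (Suc k) = U ** mat_power A k + A ** dpower A U k"

primrec ddpower :: "real^'n::finite^'n \<Rightarrow> real^'n^'n \<Rightarrow> real^'n^'n \<Rightarrow> nat \<Rightarrow> real^'n^'n" where
  "ddpower A V U 0 = 0"
| "ddpower A V U (Suc k) = U ** dpower A V k + V ** dpower A U k + A ** ddpower A V U k"

lemma has_derivative_mat_power:
  "((\<lambda>A. mat_power A k) has_derivative (\<lambda>U. dpower A U k)) (at A within S)"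
proof (induction k)
  case (Suc k)
  show ?case
    by (rule has_derivative_eq_rhs, simp, rule matrix_mult.FDERIV[OF has_derivative_ident Suc])
      (simp add: add.commute)
qed simp

lemma has_derivative_dpower:
  "((\<lambda>A. dpower A U k) has_derivative (\<lambda>V. ddpower A V U k)) (at A within S)"
proof (induction k)
  case (Suc k)
  show ?case
    unfolding dpower.simps
    by (rule has_derivative_eq_rhs[OF has_derivative_add[OF
        matrix_mult.FDERIV[OF has_derivative_const has_derivative_mat_power]
        matrix_mult.FDERIV[OF has_derivative_ident Suc]]])
      (simp add: algebra_simps matrix_mult.zero_left)
qed simp

text \<open>An operator norm bound: the eigenvalues of \<open>A\<close> may all lie in the unit disc although
  \<open>norm A\<close>, the Frobenius norm, exceeds \<open>1\<close>.\<close>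

definition contractions :: "real \<Rightarrow> (real^'n::finite^'n) set" where
  "contractions \<rho> = {A. \<forall>B. norm (A ** B) \<le> \<rho> * norm B \<and> norm (B ** A) \<le> \<rho> * norm B}"

text \<open>Series are differentiated termwise on a convex set. As this set is not open in general,
  their derivatives are taken within it, and the restriction is lifted only in
  \<open>trace_power_calculus\<close>.\<close>

lemma convex_contractions: "convex (contractions \<rho> :: (real^'n::finite^'n) set)"
proof (rule convexI)
  fix A A' :: "real^'n^'n" and s t :: real
  assume A: "A \<in> contractions \<rho>" "A' \<in> contractions \<rho>" and st: "0 \<le> s" "0 \<le> t" "s + t = 1"
  have *: "norm (s *\<^sub>R X + t *\<^sub>R Y) \<le> \<rho> * norm B" if "norm X \<le> \<rho> * norm B" "norm Y \<le> \<rho> * norm B"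
    for X Y B :: "real^'n^'n"
  proof -
    have "norm (s *\<^sub>R X + t *\<^sub>R Y) \<le> s * norm X + t * norm Y"
      using norm_triangle_ineq[of "s *\<^sub>R X" "t *\<^sub>R Y"] st by simp
    also have "\<dots> \<le> s * (\<rho> * norm B) + t * (\<rho> * norm B)"
      using that st by (intro add_mono mult_left_mono) auto
    finally show ?thesis using st by (simp flip: distrib_right)
  qed
  show "s *\<^sub>R A + t *\<^sub>R A' \<in> contractions \<rho>"
    using A by (auto simp: contractions_def matrix_mult.add_left matrix_mult.add_right
        matrix_mult.scaleR_left matrix_mult.scaleR_right intro: *)
qed

text \<open>The Frobenius norm dominates the operator norm, so a Frobenius ball around A shares one
  contraction bound, as uniform convergence requires.\<close>

lemma contractions_perturb:
  fixes A :: "real^'n::finite^'n"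
  assumes "A \<in> contractions \<rho>" "norm (A' - A) \<le> \<delta>"
  shows "A' \<in> contractions (\<rho> + \<delta>)"
proof -
  have eq: "A' = A + (A' - A)" by simp
  have "norm (A' ** B) \<le> (\<rho> + \<delta>) * norm B" for B :: "real^'n^'n"
  proof -
    have "norm (A' ** B) \<le> norm (A ** B) + norm ((A' - A) ** B)"
      by (subst eq, subst matrix_mult.add_left, rule norm_triangle_ineq)
    also have "\<dots> \<le> \<rho> * norm B + \<delta> * norm B"
      using assms by (intro add_mono order_trans[OF norm_matrix_mult_le[of "A' - A"]] mult_right_mono)
        (auto simp: contractions_def)
    finally show ?thesis by (simp add: algebra_simps)
  qed
  moreover have "norm (B ** A') \<le> (\<rho> + \<delta>) * norm B" for B :: "real^'n^'n"
  proof -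
    have "norm (B ** A') \<le> norm (B ** A) + norm (B ** (A' - A))"
      by (subst eq, subst matrix_mult.add_right, rule norm_triangle_ineq)
    also have "\<dots> \<le> \<rho> * norm B + norm B * \<delta>"
      using assms by (intro add_mono order_trans[OF norm_matrix_mult_le[of _ "A' - A"]] mult_left_mono)
        (auto simp: contractions_def)
    finally show ?thesis by (simp add: algebra_simps)
  qed
  ultimately show ?thesis by (simp add: contractions_def)
qed

context
  fixes A :: "real^'n::finite^'n" and \<rho> :: real
  assumes A: "A \<in> contractions \<rho>" and \<rho>: "0 \<le> \<rho>"
begin

lemma norm_contraction_left: "norm (A ** B) \<le> \<rho> * norm B" for B :: "real^'n^'n"
  using A by (simp add: contractions_def)

lemma norm_mult_mat_power: "norm (U ** mat_power A k) \<le> \<rho> ^ k * norm U" for U :: "real^'n^'n"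
proof (induction k arbitrary: U)
  case (Suc k)
  have "norm (U ** A ** mat_power A k) \<le> \<rho> ^ k * norm (U ** A)" by (rule Suc)
  also have "\<dots> \<le> \<rho> ^ k * (\<rho> * norm U)"
    using A \<rho> by (intro mult_left_mono) (auto simp: contractions_def)
  finally show ?case by (simp add: matrix_mul_assoc mult_ac)
qed simp

lemma norm_dpower: "norm (dpower A U k) \<le> real k * \<rho> ^ (k - 1) * norm U"
proof (induction k)
  case (Suc k)
  have "norm (dpower A U (Suc k)) \<le> norm (U ** mat_power A k) + norm (A ** dpower A U k)"
    by (simp add: norm_triangle_ineq)
  also have "\<dots> \<le> \<rho> ^ k * norm U + \<rho> * (real k * \<rho> ^ (k - 1) * norm U)"
    using \<rho> by (intro add_mono norm_mult_mat_power order_trans[OF norm_contraction_left] mult_left_mono Suc)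
  also have "\<dots> = real (Suc k) * \<rho> ^ (Suc k - 1) * norm U"
    by (cases k) (simp_all add: algebra_simps)
  finally show ?case .
qed simp

text \<open>\<open>ddpower A V U k\<close> is a sum of k (k - 1) words, one for each ordered choice
  of places for V and U among the k factors. Truncated subtraction is harmless: for k < 2 the
  coefficient vanishes.\<close>

lemma norm_ddpower: "norm (ddpower A V U k) \<le> real k * real (k - 1) * \<rho> ^ (k - 2) * norm U * norm V"
proof (induction k)
  case (Suc k)
  have "norm (ddpower A V U (Suc k))
      \<le> norm (U ** dpower A V k) + norm (V ** dpower A U k) + norm (A ** ddpower A V U k)"
    by (simp add: norm_triangle_le add_mono norm_triangle_ineq)
  also have "\<dots> \<le> norm U * (real k * \<rho> ^ (k - 1) * norm V) + norm V * (real k * \<rho> ^ (k - 1) * norm U)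
      + \<rho> * (real k * real (k - 1) * \<rho> ^ (k - 2) * norm U * norm V)"
    using \<rho> by (intro add_mono order_trans[OF norm_matrix_mult_le] order_trans[OF norm_contraction_left]
        mult_left_mono Suc norm_dpower) auto
  also have "\<dots> = real (Suc k) * real (Suc k - 1) * \<rho> ^ (Suc k - 2) * norm U * norm V"
    by (cases k; cases "k - 1") (simp_all add: algebra_simps)
  finally show ?case .
qed simp

end

text \<open>Weierstrass test: the tails of \<open>M\<close> control those of the derivative series
  uniformly on S, relative to norm h.\<close>

lemma has_derivative_suminf:
  fixes f :: "nat \<Rightarrow> 'a::real_normed_vector \<Rightarrow> 'b::banach"
  assumes S: "convex S" "x \<in> S"
    and f': "\<And>n y. y \<in> S \<Longrightarrow> (f n has_derivative f' n y) (at y within S)"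
    and M: "\<And>n y h. y \<in> S \<Longrightarrow> norm (f' n y h) \<le> M n * norm h" "summable M"
    and sf: "\<And>y. y \<in> S \<Longrightarrow> summable (\<lambda>n. f n y)"
  shows "((\<lambda>y. \<Sum>n. f n y) has_derivative (\<lambda>h. \<Sum>n. f' n x h)) (at x within S)"
proof -
  have sM: "summable (\<lambda>n. M n * norm h)" for h :: 'a using M(2) by (rule summable_mult2)
  have sf': "summable (\<lambda>n. f' n y h)" if "y \<in> S" for y h
    by (rule summable_comparison_test'[OF sM[of h], of 0]) (use M(1) that in auto)
  have "\<exists>g. \<forall>y\<in>S. (\<lambda>n. f n y) sums g y \<and> (g has_derivative (\<lambda>h. \<Sum>n. f' n y h)) (at y within S)"
  proof (rule has_derivative_series[OF S(1) f' _ S(2) summable_sums[OF sf[OF S(2)]]])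
    fix e :: real assume e: "e > 0"
    have "\<forall>\<^sub>F n in sequentially. norm (\<Sum>i. M (i + n)) < e"
      using suminf_exist_split[OF e M(2)] by (auto simp: eventually_sequentially)
    then show "\<forall>\<^sub>F n in sequentially. \<forall>y\<in>S. \<forall>h. norm ((\<Sum>i<n. f' i y h) - (\<Sum>i. f' i y h)) \<le> e * norm h"
    proof (rule eventually_mono, intro ballI allI)
      fix n y h assume n: "norm (\<Sum>i. M (i + n)) < e" and y: "y \<in> S"
      have "norm ((\<Sum>i<n. f' i y h) - (\<Sum>i. f' i y h)) = norm (\<Sum>i. f' (i + n) y h)"
        by (simp add: suminf_minus_initial_segment[OF sf'[OF y]] norm_minus_commute)
      also have "\<dots> \<le> (\<Sum>i. M (i + n) * norm h)"
        using M(1)[OF y] summable_ignore_initial_segment[OF sM[of h], of n] by (intro norm_suminf_le)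
      also have "\<dots> = (\<Sum>i. M (i + n)) * norm h"
        using summable_ignore_initial_segment[OF M(2), of n] by (rule suminf_mult2[symmetric])
      also have "\<dots> \<le> e * norm h"
        using n by (intro mult_right_mono) auto
      finally show "norm ((\<Sum>i<n. f' i y h) - (\<Sum>i. f' i y h)) \<le> e * norm h" .
    qed
  qed
  then obtain g where g: "\<And>y. y \<in> S \<Longrightarrow> (\<lambda>n. f n y) sums g y"
      "(g has_derivative (\<lambda>h. \<Sum>n. f' n x h)) (at x within S)" using S(2) by blast
  show ?thesis
    by (rule has_derivative_transform[OF S(2) _ g(2)]) (metis g(1) sums_unique)
qed

definition mat_series :: "(nat \<Rightarrow> real) \<Rightarrow> real^'n::finite^'n \<Rightarrow> real^'n^'n" where
  "mat_series a A = (\<Sum>k. a k *\<^sub>R mat_power A k)"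
definition dseries :: "(nat \<Rightarrow> real) \<Rightarrow> real^'n::finite^'n \<Rightarrow> real^'n^'n \<Rightarrow> real^'n^'n" where
  "dseries a A U = (\<Sum>k. a k *\<^sub>R dpower A U k)"
definition ddseries :: "(nat \<Rightarrow> real) \<Rightarrow> real^'n::finite^'n \<Rightarrow> real^'n^'n \<Rightarrow> real^'n^'n \<Rightarrow> real^'n^'n" where
  "ddseries a A V U = (\<Sum>k. a k *\<^sub>R ddpower A V U k)"

context
  fixes a :: "nat \<Rightarrow> real" and \<rho> :: real
  assumes a: "\<And>x :: real. \<bar>x\<bar> < 1 \<Longrightarrow> summable (\<lambda>k. a k * x ^ k)" and \<rho>: "0 \<le> \<rho>" "\<rho> < 1"
begin

lemma summable_abs_power: "\<bar>x\<bar> < 1 \<Longrightarrow> summable (\<lambda>k. \<bar>a k\<bar> * x ^ k)"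
proof -
  assume x: "\<bar>x :: real\<bar> < 1"
  obtain r where r: "\<bar>x\<bar> < r" "r < 1" using dense x by blast
  have "summable (\<lambda>k. norm (a k * x ^ k))"
    by (rule powser_insidea[OF a[of r]]) (use r in auto)
  then have "summable (\<lambda>k. norm (\<bar>a k\<bar> * x ^ k))" by (simp add: abs_mult)
  then show ?thesis by (rule summable_norm_cancel)
qed

text \<open>A formally differentiated power series converges on the same disc; this is applied to
  the series of absolute values, once here and twice in \<open>summable_second\<close>.\<close>

lemma summable_first: "summable (\<lambda>k. \<bar>a k\<bar> * (real k * \<rho> ^ (k - 1)))"
proof -
  have "summable (\<lambda>k. diffs (\<lambda>k. \<bar>a k\<bar>) k * \<rho> ^ k)"
    by (rule termdiff_converges[of _ 1]) (use \<rho> summable_abs_power in auto)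
  then have "summable (\<lambda>k. \<bar>a (Suc k)\<bar> * (real (Suc k) * \<rho> ^ k))"
    by (simp add: diffs_def mult_ac)
  then show ?thesis by (subst summable_Suc_iff[symmetric]) simp
qed

lemma summable_second: "summable (\<lambda>k. \<bar>a k\<bar> * (real k * real (k - 1) * \<rho> ^ (k - 2)))"
proof -
  have "summable (\<lambda>k. diffs (\<lambda>k. \<bar>a k\<bar>) k * x ^ k)" if "\<bar>x\<bar> < 1" for x
    by (rule termdiff_converges[of _ 1]) (use that summable_abs_power in auto)
  then have "summable (\<lambda>k. diffs (diffs (\<lambda>k. \<bar>a k\<bar>)) k * \<rho> ^ k)"
    by (rule termdiff_converges[rotated]) (use \<rho> in auto)
  then have "summable (\<lambda>k. \<bar>a (Suc (Suc k))\<bar> * (real (Suc (Suc k)) * real (Suc k) * \<rho> ^ k))"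
    by (simp add: diffs_def mult_ac)
  then show ?thesis
    by (subst summable_Suc_iff[symmetric], subst summable_Suc_iff[symmetric]) simp
qed

lemma summable_mat_series:
  fixes A :: "real^'n::finite^'n"
  assumes A: "A \<in> contractions \<rho>"
  shows "summable (\<lambda>k. a k *\<^sub>R mat_power A k)"
proof (rule summable_comparison_test'[of "\<lambda>k. \<bar>a k\<bar> * \<rho> ^ k * norm (mat 1 :: real^'n^'n)" 0])
  show "summable (\<lambda>k. \<bar>a k\<bar> * \<rho> ^ k * norm (mat 1 :: real^'n^'n))"
    using summable_abs_power[of \<rho>] \<rho> by (intro summable_mult2) auto
  show "norm (a k *\<^sub>R mat_power A k) \<le> \<bar>a k\<bar> * \<rho> ^ k * norm (mat 1 :: real^'n^'n)" for k
    using norm_mult_mat_power[OF A \<rho>(1), of "mat 1" k] by (simp add: mult_left_mono mult.assoc)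
qed

lemma summable_dseries:
  fixes A :: "real^'n::finite^'n"
  assumes A: "A \<in> contractions \<rho>"
  shows "summable (\<lambda>k. a k *\<^sub>R dpower A U k)"
proof (rule summable_comparison_test'[OF summable_mult2[OF summable_first, of "norm U"], of 0])
  show "norm (a k *\<^sub>R dpower A U k) \<le> \<bar>a k\<bar> * (real k * \<rho> ^ (k - 1)) * norm U" for k
    using norm_dpower[OF A \<rho>(1), of U k] by (simp add: mult_left_mono mult.assoc)
qed

lemma summable_ddseries:
  fixes A :: "real^'n::finite^'n"
  assumes A: "A \<in> contractions \<rho>"
  shows "summable (\<lambda>k. a k *\<^sub>R ddpower A V U k)"
proof (rule summable_comparison_test'[OF summable_mult2[OF summable_second, of "norm U * norm V"], of 0])
  show "norm (a k *\<^sub>R ddpower A V U k) \<le> \<bar>a k\<bar> * (real k * real (k - 1) * \<rho> ^ (k - 2)) * (norm U * norm V)" for k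
    using norm_ddpower[OF A \<rho>(1), of V U k] by (simp add: mult_left_mono mult.assoc)
qed

lemma has_derivative_mat_series:
  assumes A: "A \<in> contractions \<rho>"
  shows "(mat_series a has_derivative dseries a A) (at A within contractions \<rho>)"
  unfolding mat_series_def[abs_def] dseries_def
proof (rule has_derivative_suminf[OF convex_contractions A])
  show "((\<lambda>A. a k *\<^sub>R mat_power A k) has_derivative (\<lambda>U. a k *\<^sub>R dpower B U k)) (at B within contractions \<rho>)"
    for k B by (intro has_derivative_scaleR_right has_derivative_mat_power)
  show "norm (a k *\<^sub>R dpower B U k) \<le> \<bar>a k\<bar> * (real k * \<rho> ^ (k - 1)) * norm U"
    if "B \<in> contractions \<rho>" for B U k
    using norm_dpower[OF that \<rho>(1), of U k] by (simp add: mult_left_mono mult.assoc)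
qed (use summable_first summable_mat_series in simp_all)

lemma has_derivative_dseries:
  assumes A: "A \<in> contractions \<rho>"
  shows "((\<lambda>A. dseries a A U) has_derivative (\<lambda>V. ddseries a A V U)) (at A within contractions \<rho>)"
  unfolding dseries_def[abs_def] ddseries_def
proof (rule has_derivative_suminf[OF convex_contractions A])
  show "((\<lambda>A. a k *\<^sub>R dpower A U k) has_derivative (\<lambda>V. a k *\<^sub>R ddpower B V U k)) (at B within contractions \<rho>)"
    for k B by (intro has_derivative_scaleR_right has_derivative_dpower)
  show "norm (a k *\<^sub>R ddpower B V U k)
      \<le> \<bar>a k\<bar> * (real k * real (k - 1) * \<rho> ^ (k - 2)) * norm U * norm V"
    if "B \<in> contractions \<rho>" for B V k
    using norm_ddpower[OF that \<rho>(1), of V U k] by (simp add: mult_left_mono mult.assoc)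
qed (use summable_mult2[OF summable_second, of "norm U"] summable_dseries in simp_all)

end

section \<open>Divided differences of real powers\<close>

text \<open>At a = b division by zero yields 0 and not the derivative. Coinciding points are
  therefore treated through \<open>kernel2\<close> and \<open>kernel3\<close>, by
  continuity.\<close>

definition ddiff :: "(real \<Rightarrow> real) \<Rightarrow> real \<Rightarrow> real \<Rightarrow> real" where
  "ddiff f a b = (f a - f b) / (a - b)"
definition ddiff2 :: "(real \<Rightarrow> real) \<Rightarrow> real \<Rightarrow> real \<Rightarrow> real \<Rightarrow> real" where
  "ddiff2 f a b c = (ddiff f a b - ddiff f b c) / (a - c)"

lemma ddiff_commute: "ddiff f a b = ddiff f b a"
  by (simp add: ddiff_def minus_divide_divide[of "f a - f b", symmetric] del: minus_divide_divide)

text \<open>This partial fraction form is symmetric in the three nodes, so it yields all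
  permutations.\<close>

lemma ddiff2_eq:
  assumes "a \<noteq> b" "b \<noteq> c" "a \<noteq> c"
  shows "ddiff2 f a b c = f a / ((a - b) * (a - c)) + f b / ((b - a) * (b - c)) + f c / ((c - a) * (c - b))"
proof -
  have *: "((x - y) / u - (y - z) / v) / (u + v) = x / (u * (u + v)) + y / - (u * v) + z / ((u + v) * v)"
    if "u \<noteq> 0" "v \<noteq> 0" "u + v \<noteq> 0" for x y z u v :: real
  proof -
    have "((x - y) / u - (y - z) / v) / (u + v) = (x * v - y * (u + v) + z * u) / (u * v * (u + v))"
      using that by (simp add: diff_frac_eq algebra_simps)
    also have "\<dots> = x / (u * (u + v)) + y / - (u * v) + z / ((u + v) * v)"
      using that by (simp add: add_divide_distrib diff_divide_distrib)
    finally show ?thesis .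
  qed
  have "- ((a - b) * (b - c)) = (b - a) * (b - c)" "(a - c) * (b - c) = (c - a) * (c - b)"
    by (simp_all add: algebra_simps)
  then show ?thesis
    using *[of "a - b" "b - c" "f a" "f b" "f c"] assms by (simp add: ddiff2_def ddiff_def)
qed

lemma ddiff2_rotate:
  assumes "a \<noteq> b" "b \<noteq> c" "a \<noteq> c"
  shows "ddiff2 f a b c = ddiff2 f b a c" "ddiff2 f a b c = ddiff2 f a c b"
  using assms by (simp_all add: ddiff2_eq mult.commute)

text \<open>Up to the factor (p + 1) s, the two sides are the integrals over [a, c] of (A + s (u -
  a)) ^ p and (w u) ^ p, and \<open>le\<close> compares the bases.\<close>

lemma powr_scaled_increment_le:
  fixes p s a c u :: real
  assumes p: "p > 0" and D: "a \<le> c" "0 \<le> s"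
    and pos: "\<And>u. \<lbrakk>a \<le> u; u \<le> c\<rbrakk> \<Longrightarrow> 0 < u \<and> 0 < A + s * (u - a)"
    and le: "\<And>u. \<lbrakk>a \<le> u; u \<le> c\<rbrakk> \<Longrightarrow> A + s * (u - a) \<le> w * u" and w: "0 < w"
  shows "(A + s * (c - a)) powr (p + 1) - A powr (p + 1)
    \<le> s * w powr p * (c powr (p + 1) - a powr (p + 1))"
proof -
  let ?k = "\<lambda>u. s * w powr p * u powr (p + 1) - (A + s * (u - a)) powr (p + 1)"
  have "?k a \<le> ?k c"
  proof (rule DERIV_nonneg_imp_nondecreasing[OF D(1)])
    fix u assume u: "a \<le> u" "u \<le> c"
    have "(A + s * (u - a)) powr p \<le> w powr p * u powr p"
      using le[OF u] pos[OF u] w p by (subst powr_mult[symmetric]) (auto intro!: powr_mono2)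
    then have "0 \<le> (p + 1) * s * (w powr p * u powr p - (A + s * (u - a)) powr p)"
      using p D by simp
    moreover have "DERIV ?k u :> (p + 1) * s * (w powr p * u powr p - (A + s * (u - a)) powr p)"
      using pos[OF u] by (auto intro!: derivative_eq_intros simp: algebra_simps)
    ultimately show "\<exists>y. DERIV ?k u :> y \<and> y \<ge> 0" by blast
  qed
  then show ?thesis by (simp add: algebra_simps)
qed

text \<open>The second divided difference is an average of the first ones over the segment joining
  \<open>(a, a)\<close> to \<open>(b, c)\<close>; both bounds below compare antiderivatives of such averages instead of
  introducing the integrals.\<close>

lemma ddiff2_powr_le_ddiff:
  assumes p: "p > 0" and ac: "0 < a" "a < c" "c < b"
  shows "ddiff2 (\<lambda>t. t powr (p + 2)) a b c \<le> (p + 2) / 2 * ddiff (\<lambda>t. t powr (p + 1)) b c"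
proof -
  define C where "C = b powr (p + 1) - c powr (p + 1)"
  define x z where "x s = a + s * (b - a)" and "z s = a + s * (c - a)" for s :: real
  \<comment> \<open>Antiderivative of C s - (x(s) ^ (p + 1) - z(s) ^ (p + 1)); the subtracted
    increment belongs to the segment [c, b] shrunk by s towards a. The 1/2 in the claim is the
    integral of s over [0, 1].\<close>
  let ?\<Phi> = "\<lambda>s. C * s\<^sup>2 / 2 - (x s powr (p + 2) / (b - a) - z s powr (p + 2) / (c - a)) / (p + 2)"
  have "?\<Phi> 0 \<le> ?\<Phi> 1"
  proof (rule DERIV_nonneg_imp_nondecreasing[where f="?\<Phi>"])
    fix s :: real assume s: "0 \<le> s" "s \<le> 1"
    have pos: "0 < x s" "0 < z s"
      using s ac by (auto simp: x_def z_def intro!: add_pos_nonneg)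
    have "(z s + s * (b - c)) powr (p + 1) - z s powr (p + 1) \<le> s * 1 powr p * (b powr (p + 1) - c powr (p + 1))"
    proof (rule powr_scaled_increment_le[OF p])
      fix u assume u: "c \<le> u" "u \<le> b"
      \<comment> \<open>Shrinking towards the least node a moves every point u of [c, b]
        downwards.\<close>
      have "0 \<le> (1 - s) * (u - a)" using u s ac by auto
      then show "z s + s * (u - c) \<le> 1 * u" by (simp add: z_def algebra_simps)
      show "0 < u \<and> 0 < z s + s * (u - c)" using u s ac pos by (auto intro: add_pos_nonneg)
    qed (use ac s in auto)
    moreover have "z s + s * (b - c) = x s" by (simp add: x_def z_def algebra_simps)
    ultimately have "0 \<le> C * s - (x s powr (p + 1) - z s powr (p + 1))" by (simp add: C_def mult.commute)
    moreover have "DERIV ?\<Phi> s :> C * s - (x s powr (p + 1) - z s powr (p + 1))"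
    proof -
      have dx: "DERIV x s :> b - a" unfolding x_def by (auto intro!: derivative_eq_intros)
      have dz: "DERIV z s :> c - a" unfolding z_def by (auto intro!: derivative_eq_intros)
      have 1: "DERIV (\<lambda>s. x s powr (p + 2) / (b - a)) s :> (p + 2) * x s powr (p + 1)"
        by (rule DERIV_cong[OF DERIV_cdivide[OF DERIV_fun_powr[OF dx pos(1)]]]) (use ac p in \<open>simp add: add_diff_eq[symmetric] divide_simps\<close>)
      have 2: "DERIV (\<lambda>s. z s powr (p + 2) / (c - a)) s :> (p + 2) * z s powr (p + 1)"
        by (rule DERIV_cong[OF DERIV_cdivide[OF DERIV_fun_powr[OF dz pos(2)]]]) (use ac p in \<open>simp add: add_diff_eq[symmetric] divide_simps\<close>)
      have 3: "DERIV (\<lambda>s. C * s\<^sup>2 / 2) s :> C * s"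
        by (auto intro!: derivative_eq_intros)
      show ?thesis
        using DERIV_diff[OF 3 DERIV_cdivide[OF DERIV_diff[OF 1 2], of "p + 2"]] p
        by (simp flip: right_diff_distrib)
    qed
    ultimately show "\<exists>y. DERIV ?\<Phi> s :> y \<and> y \<ge> 0" by blast
  qed simp
  then have "- ((a powr (p + 2) / (b - a) - a powr (p + 2) / (c - a)) / (p + 2))
      \<le> C / 2 - (b powr (p + 2) / (b - a) - c powr (p + 2) / (c - a)) / (p + 2)"
    unfolding x_def z_def by simp
  moreover have frac: "((B - A) / u - (D - A) / v) / l = (B / u - D / v) / l - (A / u - A / v) / l"
    for A B D u v l :: real by (simp add: diff_divide_distrib)
  ultimately have "(ddiff (\<lambda>t. t powr (p + 2)) b a - ddiff (\<lambda>t. t powr (p + 2)) c a) / (p + 2) \<le> C / 2"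
    unfolding ddiff_def frac by linarith
  then have "ddiff (\<lambda>t. t powr (p + 2)) b a - ddiff (\<lambda>t. t powr (p + 2)) a c \<le> (p + 2) / 2 * C"
    using p by (simp add: field_simps ddiff_commute[of _ c a])
  then have "ddiff2 (\<lambda>t. t powr (p + 2)) b a c \<le> (p + 2) / 2 * C / (b - c)"
    using ac unfolding ddiff2_def by (intro divide_right_mono) auto
  then show ?thesis
    using ac ddiff2_rotate(1)[of a b c] by (simp add: C_def ddiff_def)
qed

text \<open>The factor \<open>1 - r\<close> is compared with \<open>1/2\<close> by Chebyshev's inequality.\<close>

lemma ddiff2_powr_le_product:
  assumes p: "p > 0" and ab: "0 < k" "k \<le> a" "a < b" "a < c" "b \<noteq> c"
  shows "ddiff2 (\<lambda>t. t powr (p + 2)) a b c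
    \<le> (p + 2) / (2 * (p + 1)) * k powr (- p)
      * ddiff (\<lambda>t. t powr (p + 1)) a b * ddiff (\<lambda>t. t powr (p + 1)) a c"
proof -
  define C where "C = k powr (- p) * (c powr (p + 1) - a powr (p + 1))"
  \<comment> \<open>\<open>x\<close> runs along the side from a to b and \<open>z\<close> from c to
    b; the slice between them has signed length (1 - r) (c - a). \<open>m\<close> below is the value
    of x ^ p at the midpoint.\<close>
  define x z where "x r = a + r * (b - a)" and "z r = a + r * (b - a) + (1 - r) * (c - a)" for r :: real
  define m where "m = x (1/2) powr p"
  \<comment> \<open>The term with \<open>m\<close> vanishes at r = 0 and r = 1, so the Chebyshev
    correction does not affect the comparison of the end values.\<close>
  let ?\<Phi> = "\<lambda>r. C * (x r powr (p + 1) / (2 * (p + 1) * (b - a)) + (r - r\<^sup>2) / 2 * m)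
      - (z r powr (p + 2) / (b - c) - x r powr (p + 2) / (b - a)) / (p + 2)"
  have C: "C \<ge> 0" using ab p unfolding C_def by (intro mult_nonneg_nonneg) (auto intro!: powr_mono2)
  have "?\<Phi> 0 \<le> ?\<Phi> 1"
  proof (rule DERIV_nonneg_imp_nondecreasing[where f="?\<Phi>"])
    fix r :: real assume r: "0 \<le> r" "r \<le> 1"
    have xa: "a \<le> x r" using r ab by (simp add: x_def)
    have pos: "0 < x r" "0 < z r"
      using r ab by (auto simp: x_def z_def intro!: add_pos_nonneg)
    have "(x r + (1 - r) * (c - a)) powr (p + 1) - x r powr (p + 1)
        \<le> (1 - r) * (x r / k) powr p * (c powr (p + 1) - a powr (p + 1))"
    proof (rule powr_scaled_increment_le[OF p])
      fix u assume u: "a \<le> u" "u \<le> c"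
      \<comment> \<open>The aim is x + u - a \<le> x u / k, which follows from (x - k) (u - k) \<ge>
        0 and k \<le> a. It turns the power of a sum into a product of powers, hence H into a
        product of two averages.\<close>
      have "0 \<le> r * (u - a)" using u r by simp
      moreover have "k * (u - k) \<le> x r * (u - k)" using xa ab u by (intro mult_right_mono) auto
      moreover have "k * (u - a) \<le> k * (u - k)" using ab by simp
      ultimately have "k * (x r + (u - a)) \<le> x r * u" by (simp add: algebra_simps)
      then have "x r + (u - a) \<le> x r / k * u" using ab by (simp add: field_simps)
      then show "x r + (1 - r) * (u - a) \<le> x r / k * u" using \<open>0 \<le> r * (u - a)\<close> by (simp add: algebra_simps)
      show "0 < u \<and> 0 < x r + (1 - r) * (u - a)" using u r ab pos by (auto intro!: add_pos_nonneg)
    qed (use ab r pos in auto)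
    also have "\<dots> = C * ((1 - r) * x r powr p)"
      using ab pos by (simp add: C_def powr_divide powr_minus field_simps)
    also have "(1 - r) * x r powr p \<le> x r powr p / 2 + (1/2 - r) * m"
    proof -
      \<comment> \<open>x ^ p increases with r and equals \<open>m\<close> at r = 1/2, so the two
        factors have opposite signs.\<close>
      have "(1/2 - r) * (x r powr p - m) \<le> 0"
      proof (cases "r \<le> 1/2")
        case True
        then have "x r \<le> x (1/2)" using ab by (auto simp: x_def intro!: mult_right_mono)
        then have "x r powr p \<le> m" unfolding m_def using pos p by (intro powr_mono2) auto
        then show ?thesis using True by (intro mult_nonneg_nonpos) auto
      next
        case False
        then have "x (1/2) \<le> x r" using ab by (auto simp: x_def intro!: mult_right_mono)
        moreover have "0 \<le> x (1/2)" using ab by (simp add: x_def)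
        ultimately have "m \<le> x r powr p" unfolding m_def using p by (intro powr_mono2) auto
        then show ?thesis using False by (intro mult_nonpos_nonneg) auto
      qed
      then show ?thesis by (simp add: algebra_simps)
    qed
    finally have "0 \<le> C * (x r powr p / 2 + (1/2 - r) * m) - (z r powr (p + 1) - x r powr (p + 1))"
      using C by (simp add: x_def z_def mult_left_mono)
    moreover have "DERIV ?\<Phi> r :> C * (x r powr p / 2 + (1/2 - r) * m) - (z r powr (p + 1) - x r powr (p + 1))"
    proof -
      have dx: "DERIV x r :> b - a" unfolding x_def by (auto intro!: derivative_eq_intros)
      have dz: "DERIV z r :> b - c" unfolding z_def by (auto intro!: derivative_eq_intros)
      have 1: "DERIV (\<lambda>r. x r powr (p + 1) / (2 * (p + 1) * (b - a))) r :> x r powr p / 2"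
        by (rule DERIV_cong[OF DERIV_cdivide[OF DERIV_fun_powr[OF dx pos(1)]]]) (use ab p in \<open>simp add: add_diff_eq[symmetric] divide_simps\<close>)
      have 2: "DERIV (\<lambda>r. x r powr (p + 2) / (b - a)) r :> (p + 2) * x r powr (p + 1)"
        by (rule DERIV_cong[OF DERIV_cdivide[OF DERIV_fun_powr[OF dx pos(1)]]]) (use ab p in \<open>simp add: add_diff_eq[symmetric] divide_simps\<close>)
      have 3: "DERIV (\<lambda>r. z r powr (p + 2) / (b - c)) r :> (p + 2) * z r powr (p + 1)"
        by (rule DERIV_cong[OF DERIV_cdivide[OF DERIV_fun_powr[OF dz pos(2)]]]) (use ab p in \<open>simp add: add_diff_eq[symmetric] divide_simps\<close>)
      have 4: "DERIV (\<lambda>r. (r - r\<^sup>2) / 2 * m) r :> (1/2 - r) * m"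
        by (auto intro!: derivative_eq_intros simp: field_simps)
      show ?thesis
        using DERIV_diff[OF DERIV_cmult[OF DERIV_add[OF 1 4], of C] DERIV_cdivide[OF DERIV_diff[OF 3 2], of "p + 2"]] p
        by (simp flip: right_diff_distrib)
    qed
    ultimately show "\<exists>y. DERIV ?\<Phi> r :> y \<and> y \<ge> 0" by blast
  qed simp
  moreover have "((B - D) / v - (B - A) / u) / l = (B / v - B / u) / l - (D / v - A / u) / l"
    for A B D u v l :: real by (simp add: diff_divide_distrib)
  moreover have "C * ((B - A) / u) / l = C * (B / (l * u)) - C * (A / (l * u))" for A B u l :: real
    by (simp add: diff_divide_distrib right_diff_distrib mult.commute)
  ultimately have "(ddiff (\<lambda>t. t powr (p + 2)) b c - ddiff (\<lambda>t. t powr (p + 2)) b a) / (p + 2)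
      \<le> C * ddiff (\<lambda>t. t powr (p + 1)) b a / (2 * (p + 1))"
    by (simp add: x_def z_def ddiff_def)
  then have "ddiff (\<lambda>t. t powr (p + 2)) c b - ddiff (\<lambda>t. t powr (p + 2)) b a
      \<le> (p + 2) / (2 * (p + 1)) * C * ddiff (\<lambda>t. t powr (p + 1)) a b"
    using p by (simp add: field_simps ddiff_commute[of _ c b] ddiff_commute[of _ b a])
  then have "ddiff2 (\<lambda>t. t powr (p + 2)) c b a
      \<le> (p + 2) / (2 * (p + 1)) * C * ddiff (\<lambda>t. t powr (p + 1)) a b / (c - a)"
    using ab unfolding ddiff2_def by (intro divide_right_mono) auto
  also have "ddiff2 (\<lambda>t. t powr (p + 2)) c b a = ddiff2 (\<lambda>t. t powr (p + 2)) a b c"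
    using ab by (simp add: ddiff2_eq mult.commute)
  also have "(p + 2) / (2 * (p + 1)) * C * ddiff (\<lambda>t. t powr (p + 1)) a b / (c - a)
      = (p + 2) / (2 * (p + 1)) * k powr (- p) * ddiff (\<lambda>t. t powr (p + 1)) a b * ddiff (\<lambda>t. t powr (p + 1)) c a"
    by (simp add: C_def ddiff_def)
  finally show ?thesis by (simp add: ddiff_commute[of _ c a])
qed

text \<open>Product of the two preceding bounds, after moving the least node to the front by
  symmetry; 4 times (p + 2) / 2 times (p + 2) / (2 (p + 1)) is the constant. The sign hypothesis
  \<open>nn\<close> allows the bounds to be multiplied.\<close>

lemma ddiff2_powr_sq_le:
  assumes p: "p > 0" and k: "0 < k" "k \<le> a" "k \<le> b" "k \<le> c" and ne: "a \<noteq> b" "b \<noteq> c" "a \<noteq> c"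
    and nn: "0 \<le> ddiff2 (\<lambda>t. t powr (p + 2)) a b c"
  defines "q \<equiv> ddiff (\<lambda>t. t powr (p + 1))"
  shows "(2 * ddiff2 (\<lambda>t. t powr (p + 2)) a b c)\<^sup>2
    \<le> (p + 2)\<^sup>2 / (p + 1) * k powr (- p) * (q a b * q b c * q c a)"
proof -
  let ?r = "ddiff2 (\<lambda>t. t powr (p + 2))"
  have *: "(2 * ?r a b c)\<^sup>2 \<le> (p + 2)\<^sup>2 / (p + 1) * k powr (- p) * (q a b * q b c * q c a)"
    if k: "k \<le> a" "a < b" "a < c" "b \<noteq> c" and nn: "0 \<le> ?r a b c" for a b c
  proof -
    have "?r a b c \<le> (p + 2) / 2 * q b c"
    proof (cases "c < b")
      case True
      then show ?thesis unfolding q_def using ddiff2_powr_le_ddiff[OF p, of a c b] k \<open>0 < k\<close> by simp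
    next
      case False
      then show ?thesis unfolding q_def using ddiff2_powr_le_ddiff[OF p, of a b c] k \<open>0 < k\<close>
          ddiff2_rotate(2)[of a b c] ddiff_commute[of _ b c] by simp
    qed
    moreover have "?r a b c \<le> (p + 2) / (2 * (p + 1)) * k powr (- p) * q a b * q a c"
      unfolding q_def by (rule ddiff2_powr_le_product) (use p k \<open>0 < k\<close> in auto)
    ultimately have "?r a b c * ?r a b c
        \<le> ((p + 2) / 2 * q b c) * ((p + 2) / (2 * (p + 1)) * k powr (- p) * q a b * q a c)"
      using nn by (intro mult_mono) auto
    then show ?thesis
      using p ddiff_commute[of _ c a] by (simp add: power2_eq_square q_def field_simps)
  qed
  have com: "q x y = q y x" for x y unfolding q_def by (rule ddiff_commute)
  consider "a < b" "a < c" | "b < a" "b < c" | "c < a" "c < b" using ne by linarith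
  then show ?thesis
  proof cases
    case 1 then show ?thesis using * k ne nn by blast
  next
    case 2
    have r: "?r a b c = ?r b a c" using ddiff2_rotate ne by auto
    show ?thesis using *[of b a c] 2 k ne nn unfolding r by (simp add: com mult_ac)
  next
    case 3
    have r: "?r a b c = ?r c a b" using ddiff2_rotate[of a c b] ddiff2_rotate[of a b c] ne by auto
    show ?thesis using *[of c a b] 3 k ne nn unfolding r by (simp add: com mult_ac)
  qed
qed

section \<open>Power series in an eigenbasis\<close>

lemma diag_mat_mult_entry:
  fixes d :: "real^'n::finite" and M :: "real^'n^'n"
  shows "(diag_mat d ** M) $ i $ j = d $ i * M $ i $ j" "(M ** diag_mat d) $ i $ j = M $ i $ j * d $ j"
  by (simp_all add: diag_mat_def matrix_matrix_mult_def if_distrib[where f="\<lambda>x. x * _"]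
      if_distrib[where f="\<lambda>x. _ * x"] cong: if_cong)

definition in_basis :: "real^'n::finite^'n \<Rightarrow> real^'n^'n \<Rightarrow> real^'n^'n" where
  "in_basis Q A = transpose Q ** A ** Q"

lemma bounded_linear_in_basis: "bounded_linear (in_basis Q)"
  unfolding in_basis_def[abs_def]
  by (rule bounded_linear_compose[OF matrix_mult.bounded_linear_left matrix_mult.bounded_linear_right])

lemmas in_basis_linear = bounded_linear.linear[OF bounded_linear_in_basis]
lemmas in_basis_add = linear_add[OF in_basis_linear]
lemmas in_basis_neg = linear_neg[OF in_basis_linear]
lemmas in_basis_zero = linear_0[OF in_basis_linear]
lemmas in_basis_scaleR = linear_scale[OF in_basis_linear]

lemma transpose_in_basis: "transpose (in_basis Q A) = in_basis Q (transpose A)"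
  by (simp add: in_basis_def matrix_transpose_mul matrix_mul_assoc)

context
  fixes Q :: "real^'n::finite^'n"
  assumes Q: "orthogonal_matrix Q"
begin

lemma orthogonal_cancel: "transpose Q ** Q = mat 1" "Q ** transpose Q = mat 1"
  using Q by (auto simp: orthogonal_matrix_def)

lemma in_basis_mult: "in_basis Q (A ** B) = in_basis Q A ** in_basis Q B"
proof -
  have "in_basis Q A ** in_basis Q B = transpose Q ** A ** (Q ** transpose Q) ** B ** Q"
    by (simp add: in_basis_def matrix_mul_assoc)
  then show ?thesis by (simp add: orthogonal_cancel in_basis_def matrix_mul_assoc)
qed

lemma trace_in_basis: "trace (in_basis Q A) = trace A"
  unfolding in_basis_def
  by (subst trace_mul_sym) (simp add: matrix_mul_assoc orthogonal_cancel)

lemma inner_in_basis: "in_basis Q A \<bullet> in_basis Q B = A \<bullet> B"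
proof -
  have *: "A \<bullet> B = trace (transpose A ** B)" for A B :: "real^'n^'n"
  proof -
    have "trace (transpose A ** B) = (\<Sum>i\<in>UNIV. \<Sum>k\<in>UNIV. A $ k $ i * B $ k $ i)"
      by (simp add: trace_def matrix_matrix_mult_def transpose_def)
    also have "\<dots> = A \<bullet> B" unfolding inner_vec_def inner_real_def by (rule sum.swap)
    finally show ?thesis by simp
  qed
  show ?thesis by (simp add: * transpose_in_basis trace_in_basis flip: in_basis_mult)
qed

lemma norm_in_basis: "norm (in_basis Q A) = norm A"
  by (simp add: norm_eq_sqrt_inner inner_in_basis)

lemma in_basis_diag: "in_basis Q (Q ** diag_mat d ** transpose Q) = diag_mat d"
proof -
  have "in_basis Q (Q ** diag_mat d ** transpose Q)
      = (transpose Q ** Q) ** diag_mat d ** (transpose Q ** Q)"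
    by (simp add: in_basis_def matrix_mul_assoc)
  then show ?thesis by (simp add: orthogonal_cancel)
qed

end

text \<open>Divided differences of \<open>x ^ k\<close>; their recursions mirror those of \<^const>\<open>dpower\<close> and
  \<^const>\<open>ddpower\<close>.\<close>

primrec mono_dd :: "real \<Rightarrow> real \<Rightarrow> nat \<Rightarrow> real" where
  "mono_dd x y 0 = 0"
| "mono_dd x y (Suc k) = y ^ k + x * mono_dd x y k"

primrec mono_dd2 :: "real \<Rightarrow> real \<Rightarrow> real \<Rightarrow> nat \<Rightarrow> real" where
  "mono_dd2 x y z 0 = 0"
| "mono_dd2 x y z (Suc k) = mono_dd y z k + x * mono_dd2 x y z k"

text \<open>The form without a quotient includes x = y, so the induction needs no case distinction
  and division is postponed to distinct points.\<close>

lemma mono_dd_mult: "(x - y) * mono_dd x y k = x ^ k - y ^ k"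
proof (induction k)
  case (Suc k)
  have "(x - y) * mono_dd x y (Suc k) = (x - y) * y ^ k + x * ((x - y) * mono_dd x y k)"
    by (simp add: algebra_simps)
  also have "\<dots> = x ^ Suc k - y ^ Suc k" unfolding Suc by (simp add: algebra_simps)
  finally show ?case .
qed simp

lemma mono_dd_commute: "mono_dd x y k = mono_dd y x k"
proof (cases "x = y")
  case False
  have "(x - y) * mono_dd x y k = (x - y) * mono_dd y x k"
    using mono_dd_mult[of x y k] mono_dd_mult[of y x k] by (simp add: left_diff_distrib)
  with False show ?thesis by simp
qed simp

lemma mono_dd2_mult: "(x - z) * mono_dd2 x y z k = mono_dd x y k - mono_dd y z k"
proof (induction k)
  case (Suc k)
  have "(x - z) * mono_dd2 x y z (Suc k) = (x - z) * mono_dd y z k + x * ((x - z) * mono_dd2 x y z k)"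
    by (simp add: algebra_simps)
  also have "\<dots> = x * mono_dd x y k - z * mono_dd y z k"
    unfolding Suc by (simp add: left_diff_distrib right_diff_distrib)
  also have "\<dots> = mono_dd x y (Suc k) - mono_dd y z (Suc k)"
    using mono_dd_mult[of y z k] by (simp add: left_diff_distrib)
  finally show ?case .
qed simp

lemma mono_dd_nonneg: "0 \<le> x \<Longrightarrow> 0 \<le> y \<Longrightarrow> 0 \<le> mono_dd x y k"
  by (induction k) auto

lemma mono_dd2_nonneg: "0 \<le> x \<Longrightarrow> 0 \<le> y \<Longrightarrow> 0 \<le> z \<Longrightarrow> 0 \<le> mono_dd2 x y z k"
  by (induction k) (auto simp: mono_dd_nonneg)

lemma mono_dd_le:
  assumes "\<bar>x\<bar> \<le> r" "\<bar>y\<bar> \<le> r"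
  shows "\<bar>mono_dd x y k\<bar> \<le> real k * r ^ (k - 1)"
proof (induction k)
  case (Suc k)
  have "\<bar>mono_dd x y (Suc k)\<bar> \<le> \<bar>y\<bar> ^ k + \<bar>x\<bar> * \<bar>mono_dd x y k\<bar>"
    using abs_triangle_ineq[of "y ^ k" "x * mono_dd x y k"] by (simp add: abs_mult power_abs)
  also have "\<dots> \<le> r ^ k + r * (real k * r ^ (k - 1))"
    using assms Suc by (intro add_mono mult_mono power_mono) auto
  also have "\<dots> = real (Suc k) * r ^ (Suc k - 1)"
    by (cases k) (simp_all add: algebra_simps)
  finally show ?case .
qed simp

text \<open>A factor 2 is given away (there are only k (k - 1) / 2 monomials), so that the majorant
  is the one in \<open>summable_second\<close>.\<close>

lemma mono_dd2_le:
  assumes "\<bar>x\<bar> \<le> r" "\<bar>y\<bar> \<le> r" "\<bar>z\<bar> \<le> r"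
  shows "\<bar>mono_dd2 x y z k\<bar> \<le> real k * real (k - 1) * r ^ (k - 2)"
proof (induction k)
  case (Suc k)
  have "\<bar>mono_dd2 x y z (Suc k)\<bar> \<le> \<bar>mono_dd y z k\<bar> + \<bar>x\<bar> * \<bar>mono_dd2 x y z k\<bar>"
    using abs_triangle_ineq[of "mono_dd y z k" "x * mono_dd2 x y z k"] by (simp add: abs_mult)
  also have "\<dots> \<le> real k * r ^ (k - 1) + r * (real k * real (k - 1) * r ^ (k - 2))"
    using assms Suc by (intro add_mono mult_mono mono_dd_le) auto
  also have "\<dots> = real (Suc k) * real (Suc k - 1) * r ^ (Suc k - 2) - real k * r ^ (k - 1)"
    by (cases k; cases "k - 1") (simp_all add: algebra_simps)
  also have "\<dots> \<le> real (Suc k) * real (Suc k - 1) * r ^ (Suc k - 2)"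
    using assms(1) by simp
  finally show ?case .
qed simp

context
  fixes Q A :: "real^'n::finite^'n" and d :: "real^'n"
  assumes Q: "orthogonal_matrix Q" and A: "A = Q ** diag_mat d ** transpose Q"
begin

lemma in_basis_eigen: "in_basis Q A = diag_mat d"
  unfolding A using Q by (rule in_basis_diag)

lemma in_basis_mat_power: "in_basis Q (mat_power A k) = diag_mat (\<chi> i. d $ i ^ k)"
proof (induction k)
  case 0
  show ?case by (simp add: in_basis_def orthogonal_cancel[OF Q]) (simp add: diag_mat_def mat_def vec_eq_iff)
next
  case (Suc k)
  then show ?case
    by (simp add: in_basis_mult[OF Q] in_basis_eigen vec_eq_iff diag_mat_mult_entry) (simp add: diag_mat_def)
qed

text \<open>Daletskii-Krein formula for the power map: conjugation by Q is multiplicative and makes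
  A diagonal, so the recursion of \<open>dpower\<close> becomes, entry by entry, that of
  \<open>mono_dd\<close>.\<close>

lemma in_basis_dpower:
  "in_basis Q (dpower A U k) $ i $ j = mono_dd (d $ i) (d $ j) k * in_basis Q U $ i $ j"
  by (induction k)
    (simp_all add: in_basis_add in_basis_zero in_basis_mult[OF Q] in_basis_eigen in_basis_mat_power
      diag_mat_mult_entry algebra_simps)

text \<open>Second-order analogue; the two products come from the two orders in which V and U occur
  in a word.\<close>

lemma in_basis_ddpower:
  "in_basis Q (ddpower A V U k) $ i $ l = (\<Sum>j\<in>UNIV. mono_dd2 (d $ i) (d $ j) (d $ l) k
    * (in_basis Q V $ i $ j * in_basis Q U $ j $ l + in_basis Q U $ i $ j * in_basis Q V $ j $ l))"
proof (induction k)
  case (Suc k)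
  have *: "in_basis Q (W ** dpower A Z k) $ i $ l
      = (\<Sum>j\<in>UNIV. mono_dd (d $ j) (d $ l) k * (in_basis Q W $ i $ j * in_basis Q Z $ j $ l))" for W Z
    unfolding in_basis_mult[OF Q]
    by (simp add: matrix_matrix_mult_def in_basis_dpower mult_ac)
  have "in_basis Q (ddpower A V U (Suc k)) $ i $ l =
      (\<Sum>j\<in>UNIV. mono_dd (d $ j) (d $ l) k * (in_basis Q U $ i $ j * in_basis Q V $ j $ l))
      + (\<Sum>j\<in>UNIV. mono_dd (d $ j) (d $ l) k * (in_basis Q V $ i $ j * in_basis Q U $ j $ l))
      + d $ i * (in_basis Q (ddpower A V U k) $ i $ l)"
    by (simp add: in_basis_add * in_basis_mult[OF Q, of A] in_basis_eigen diag_mat_mult_entry)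
  also have "\<dots> = (\<Sum>j\<in>UNIV. mono_dd2 (d $ i) (d $ j) (d $ l) (Suc k)
    * (in_basis Q V $ i $ j * in_basis Q U $ j $ l + in_basis Q U $ i $ j * in_basis Q V $ j $ l))"
    unfolding Suc sum_distrib_left sum.distrib[symmetric]
    by (intro sum.cong refl) (simp add: algebra_simps)
  finally show ?case .
qed (simp add: in_basis_zero)

text \<open>A diagonal factor on the left scales rows, and conjugation by Q is a Frobenius isometry;
  the right-hand bound follows by transposition.\<close>

lemma contractionsI_eigen:
  assumes d: "\<And>i. \<bar>d $ i\<bar> \<le> r"
  shows "A \<in> contractions r"
proof -
  have r: "0 \<le> r" using d[of undefined] by linarith
  have sq: "(d $ i)\<^sup>2 \<le> r\<^sup>2" for i
    using d[of i] r by (metis abs_ge_zero power2_abs power_mono)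
  have *: "norm (diag_mat d ** B) \<le> r * norm B" for B :: "real^'n^'n"
  proof (rule power2_le_imp_le)
    show "(norm (diag_mat d ** B))\<^sup>2 \<le> (r * norm B)\<^sup>2"
      unfolding norm_matrix_sq power_mult_distrib sum_distrib_left diag_mat_mult_entry
      by (intro sum_mono mult_right_mono sq zero_le_power2)
  qed (simp add: r)
  have l: "norm (A ** B) \<le> r * norm B" for B :: "real^'n^'n"
    using *[of "in_basis Q B"]
    by (metis in_basis_eigen in_basis_mult[OF Q] norm_in_basis[OF Q])
  have "transpose (diag_mat d) = diag_mat d"
    by (simp add: diag_mat_def transpose_def vec_eq_iff)
  then have tA: "transpose A = A"
    unfolding A by (simp add: matrix_transpose_mul matrix_mul_assoc)
  have "norm (B ** A) \<le> r * norm B" for B :: "real^'n^'n"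
  proof -
    have "norm (B ** A) = norm (A ** transpose B)"
      by (metis norm_transpose matrix_transpose_mul tA)
    also have "\<dots> \<le> r * norm B" using l[of "transpose B"] by (simp add: norm_transpose)
    finally show ?thesis .
  qed
  with l show ?thesis by (simp add: contractions_def)
qed

end

text \<open>Divided difference of the function with coefficients \<open>a\<close>, written as a
  series so that it has the correct value at x = y as well.\<close>

definition kernel2 :: "(nat \<Rightarrow> real) \<Rightarrow> real \<Rightarrow> real \<Rightarrow> real" where
  "kernel2 a x y = (\<Sum>k. a k * mono_dd x y k)"
lemma kernel2_commute: "kernel2 a x y = kernel2 a y x"
  by (simp add: kernel2_def mono_dd_commute)

definition kernel3 :: "(nat \<Rightarrow> real) \<Rightarrow> real \<Rightarrow> real \<Rightarrow> real \<Rightarrow> real" where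
  "kernel3 a x y z = (\<Sum>k. a k * mono_dd2 x y z k)"

context
  fixes a :: "nat \<Rightarrow> real" and \<rho> :: real
  assumes a: "\<And>x :: real. \<bar>x\<bar> < 1 \<Longrightarrow> summable (\<lambda>k. a k * x ^ k)" and \<rho>: "0 \<le> \<rho>" "\<rho> < 1"
begin

lemma summable_kernel2:
  assumes "\<bar>x\<bar> \<le> \<rho>" "\<bar>y\<bar> \<le> \<rho>"
  shows "summable (\<lambda>k. a k * mono_dd x y k)"
  by (rule summable_comparison_test'[OF summable_first[OF a \<rho>], of 0])
    (use mono_dd_le[OF assms] in \<open>auto simp: abs_mult intro!: mult_left_mono\<close>)

lemma summable_kernel3:
  assumes "\<bar>x\<bar> \<le> \<rho>" "\<bar>y\<bar> \<le> \<rho>" "\<bar>z\<bar> \<le> \<rho>"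
  shows "summable (\<lambda>k. a k * mono_dd2 x y z k)"
  by (rule summable_comparison_test'[OF summable_second[OF a \<rho>], of 0])
    (use mono_dd2_le[OF assms] in \<open>auto simp: abs_mult intro!: mult_left_mono\<close>)

lemma tendsto_mono_dd:
  assumes "(f \<longlongrightarrow> x) F" "(g \<longlongrightarrow> y) F"
  shows "((\<lambda>n. mono_dd (f n) (g n) k) \<longlongrightarrow> mono_dd x y k) F"
  by (induction k) (use assms in \<open>auto intro!: tendsto_intros\<close>)

lemma tendsto_mono_dd2:
  assumes "(f \<longlongrightarrow> x) F" "(g \<longlongrightarrow> y) F" "(h \<longlongrightarrow> z) F"
  shows "((\<lambda>n. mono_dd2 (f n) (g n) (h n) k) \<longlongrightarrow> mono_dd2 x y z k) F"
  by (induction k) (use assms in \<open>auto intro!: tendsto_intros tendsto_mono_dd\<close>)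

text \<open>Tannery's theorem with the majorant of \<open>summable_first\<close>. This continuity
  carries the kernel inequality over to coinciding eigenvalues.\<close>

lemma tendsto_kernel2:
  assumes "(f \<longlongrightarrow> x) F" "(g \<longlongrightarrow> y) F" "F \<noteq> bot"
    and "eventually (\<lambda>n. \<bar>f n\<bar> \<le> \<rho> \<and> \<bar>g n\<bar> \<le> \<rho>) F"
  shows "((\<lambda>n. kernel2 a (f n) (g n)) \<longlongrightarrow> kernel2 a x y) F"
  unfolding kernel2_def
proof (rule tannerys_theorem[THEN conjunct2, THEN conjunct2])
  show "((\<lambda>n. a k * mono_dd (f n) (g n) k) \<longlongrightarrow> a k * mono_dd x y k) F" for k
    using assms by (intro tendsto_intros tendsto_mono_dd)
  show "eventually (\<lambda>(k, n). norm (a k * mono_dd (f n) (g n) k) \<le> \<bar>a k\<bar> * (real k * \<rho> ^ (k - 1))) (at_top \<times>\<^sub>F F)"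
    by (rule eventually_mono[OF eventually_prodI[OF eventually_True assms(4)]])
      (auto simp: abs_mult simp del: One_nat_def intro!: mult_left_mono mono_dd_le)
qed (use assms summable_first[OF a \<rho>] in auto)

lemma tendsto_kernel3:
  assumes "(f \<longlongrightarrow> x) F" "(g \<longlongrightarrow> y) F" "(h \<longlongrightarrow> z) F" "F \<noteq> bot"
    and "eventually (\<lambda>n. \<bar>f n\<bar> \<le> \<rho> \<and> \<bar>g n\<bar> \<le> \<rho> \<and> \<bar>h n\<bar> \<le> \<rho>) F"
  shows "((\<lambda>n. kernel3 a (f n) (g n) (h n)) \<longlongrightarrow> kernel3 a x y z) F"
  unfolding kernel3_def
proof (rule tannerys_theorem[THEN conjunct2, THEN conjunct2])
  show "((\<lambda>n. a k * mono_dd2 (f n) (g n) (h n) k) \<longlongrightarrow> a k * mono_dd2 x y z k) F" for k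
    using assms by (intro tendsto_intros tendsto_mono_dd2)
  show "eventually (\<lambda>(k, n). norm (a k * mono_dd2 (f n) (g n) (h n) k)
      \<le> \<bar>a k\<bar> * (real k * real (k - 1) * \<rho> ^ (k - 2))) (at_top \<times>\<^sub>F F)"
    by (rule eventually_mono[OF eventually_prodI[OF eventually_True assms(5)]])
      (auto simp: abs_mult simp del: One_nat_def intro!: mult_left_mono mono_dd2_le)
qed (use assms summable_second[OF a \<rho>] in auto)

lemma kernel2_eq_ddiff:
  assumes "\<bar>x\<bar> \<le> \<rho>" "\<bar>y\<bar> \<le> \<rho>" "x \<noteq> y" and F: "\<And>t. \<bar>t\<bar> \<le> \<rho> \<Longrightarrow> (\<lambda>k. a k * t ^ k) sums F t"
  shows "kernel2 a x y = ddiff F x y"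
proof -
  have "(\<lambda>k. a k * x ^ k - a k * y ^ k) sums (F x - F y)"
    using F assms by (intro sums_diff) auto
  moreover have "a k * x ^ k - a k * y ^ k = (x - y) * (a k * mono_dd x y k)" for k
    using mono_dd_mult[of x y k] by (simp flip: right_diff_distrib add: mult.left_commute)
  ultimately have "(\<lambda>k. (x - y) * (a k * mono_dd x y k)) sums (F x - F y)" by simp
  moreover have "(\<lambda>k. (x - y) * (a k * mono_dd x y k)) sums ((x - y) * kernel2 a x y)"
    unfolding kernel2_def using assms by (intro sums_mult summable_sums summable_kernel2)
  ultimately have "(x - y) * kernel2 a x y = F x - F y" using sums_unique2 by blast
  then show ?thesis using assms(3) by (simp add: ddiff_def field_simps)
qed

lemma kernel3_eq_ddiff2:
  assumes "\<bar>x\<bar> \<le> \<rho>" "\<bar>y\<bar> \<le> \<rho>" "\<bar>z\<bar> \<le> \<rho>" "x \<noteq> y" "y \<noteq> z" "x \<noteq> z"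
    and F: "\<And>t. \<bar>t\<bar> \<le> \<rho> \<Longrightarrow> (\<lambda>k. a k * t ^ k) sums F t"
  shows "kernel3 a x y z = ddiff2 F x y z"
proof -
  have "(\<lambda>k. a k * mono_dd x y k - a k * mono_dd y z k) sums (kernel2 a x y - kernel2 a y z)"
    unfolding kernel2_def using assms by (intro sums_diff summable_sums summable_kernel2)
  moreover have "a k * mono_dd x y k - a k * mono_dd y z k = (x - z) * (a k * mono_dd2 x y z k)" for k
    using mono_dd2_mult[of x z y k] by (simp flip: right_diff_distrib add: mult.left_commute)
  ultimately have "(\<lambda>k. (x - z) * (a k * mono_dd2 x y z k)) sums (kernel2 a x y - kernel2 a y z)" by simp
  moreover have "(\<lambda>k. (x - z) * (a k * mono_dd2 x y z k)) sums ((x - z) * kernel3 a x y z)"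
    unfolding kernel3_def using assms by (intro sums_mult summable_sums summable_kernel3)
  ultimately have "(x - z) * kernel3 a x y z = kernel2 a x y - kernel2 a y z" using sums_unique2 by blast
  then show ?thesis using assms kernel2_eq_ddiff[OF _ _ _ F] by (simp add: ddiff2_def field_simps)
qed

lemma in_basis_dseries:
  assumes Q: "orthogonal_matrix Q" and A: "A = Q ** diag_mat d ** transpose Q" and d: "\<And>i. \<bar>d $ i\<bar> \<le> \<rho>"
  shows "in_basis Q (dseries a A U) $ i $ j = kernel2 a (d $ i) (d $ j) * in_basis Q U $ i $ j"
proof -
  have bl: "bounded_linear (\<lambda>M. in_basis Q M $ i $ j)"
    by (intro bounded_linear_compose[OF bounded_linear_vec_nth] bounded_linear_in_basis)
  have "summable (\<lambda>k. a k *\<^sub>R dpower A U k)"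
    using summable_dseries[OF a \<rho> contractionsI_eigen[OF Q A d]] .
  then have "in_basis Q (dseries a A U) $ i $ j = (\<Sum>k. in_basis Q (a k *\<^sub>R dpower A U k) $ i $ j)"
    unfolding dseries_def by (rule bounded_linear.suminf[OF bl])
  also have "\<dots> = (\<Sum>k. a k * mono_dd (d $ i) (d $ j) k * in_basis Q U $ i $ j)"
    by (simp add: in_basis_scaleR in_basis_dpower[OF Q A] mult.assoc)
  also have "\<dots> = kernel2 a (d $ i) (d $ j) * in_basis Q U $ i $ j"
    unfolding kernel2_def using d by (intro suminf_mult2[symmetric] summable_kernel2)
  finally show ?thesis .
qed

lemma in_basis_ddseries:
  assumes Q: "orthogonal_matrix Q" and A: "A = Q ** diag_mat d ** transpose Q" and d: "\<And>i. \<bar>d $ i\<bar> \<le> \<rho>"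
  shows "in_basis Q (ddseries a A V U) $ i $ l = (\<Sum>j\<in>UNIV. kernel3 a (d $ i) (d $ j) (d $ l)
    * (in_basis Q V $ i $ j * in_basis Q U $ j $ l + in_basis Q U $ i $ j * in_basis Q V $ j $ l))"
    (is "_ = (\<Sum>j\<in>UNIV. _ * ?w j)")
proof -
  have bl: "bounded_linear (\<lambda>M. in_basis Q M $ i $ l)"
    by (intro bounded_linear_compose[OF bounded_linear_vec_nth] bounded_linear_in_basis)
  have "summable (\<lambda>k. a k *\<^sub>R ddpower A V U k)"
    using summable_ddseries[OF a \<rho> contractionsI_eigen[OF Q A d]] .
  then have "in_basis Q (ddseries a A V U) $ i $ l = (\<Sum>k. in_basis Q (a k *\<^sub>R ddpower A V U k) $ i $ l)"
    unfolding ddseries_def by (rule bounded_linear.suminf[OF bl])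
  also have "\<dots> = (\<Sum>k. \<Sum>j\<in>UNIV. a k * mono_dd2 (d $ i) (d $ j) (d $ l) k * ?w j)"
    by (simp add: in_basis_scaleR in_basis_ddpower[OF Q A] mult.assoc sum_distrib_left)
  also have "\<dots> = (\<Sum>j\<in>UNIV. \<Sum>k. a k * mono_dd2 (d $ i) (d $ j) (d $ l) k * ?w j)"
    using d by (intro suminf_sum summable_mult2 summable_kernel3)
  also have "\<dots> = (\<Sum>j\<in>UNIV. kernel3 a (d $ i) (d $ j) (d $ l) * ?w j)"
    unfolding kernel3_def using d
    by (intro sum.cong refl suminf_mult2[symmetric] summable_kernel3)
  finally show ?thesis .
qed

end

section \<open>The kernel inequality\<close>

text \<open>Taylor coefficients of (1 - t) ^ (- q) at 0.\<close>

definition neg_binomial :: "real \<Rightarrow> nat \<Rightarrow> real" where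
  "neg_binomial q k = pochhammer q k / fact k"

lemma sums_neg_binomial: "\<bar>t\<bar> < 1 \<Longrightarrow> (\<lambda>k. neg_binomial q k * t ^ k) sums (1 - t) powr (- q)"
proof -
  assume "\<bar>t\<bar> < 1"
  then have "(\<lambda>k. ((- q) gchoose k) * (- t) ^ k) sums (1 - t) powr (- q)"
    using gen_binomial_real[of "- t" "- q"] by simp
  moreover have "((- q) gchoose k) * (- t) ^ k = neg_binomial q k * t ^ k" for k
    by (simp add: neg_binomial_def gbinomial_pochhammer power_minus[of t])
  ultimately show ?thesis by simp
qed

text \<open>Coefficient form of the derivative rule for (1 - t) ^ (- q).\<close>

lemma neg_binomial_Suc: "neg_binomial q (Suc k) * real (Suc k) = q * neg_binomial (q + 1) k"
  by (simp add: neg_binomial_def pochhammer_rec field_simps del: of_nat_Suc)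

text \<open>Passage from eigenvalues to their reciprocals: in s = 1 / (1 - x) the function F is p s
  ^ (p + 1), and x - y = (s - t) / (s t).\<close>

lemma ddiff_recip:
  fixes p x y :: real
  assumes "x < 1" "y < 1" "x \<noteq> y"
  defines "s \<equiv> 1 / (1 - x)" and "t \<equiv> 1 / (1 - y)" and "F \<equiv> \<lambda>x. p * (1 - x) powr (- (p + 1))"
  shows "ddiff F x y = p * s * t * ddiff (\<lambda>s. s powr (p + 1)) s t"
proof -
  have F: "F z = p * (1 / (1 - z)) powr (p + 1)" if "z < 1" for z
    unfolding F_def using that by (subst powr_minus_divide) (simp add: powr_divide)
  have pos: "s > 0" "t > 0" "s \<noteq> t" using assms by (auto simp: s_def t_def divide_simps)
  have xy: "x - y = (s - t) / (s * t)" using assms by (simp add: s_def t_def divide_simps)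
  show ?thesis
    unfolding ddiff_def F[OF assms(1)] F[OF assms(2)] xy s_def[symmetric] t_def[symmetric]
    using pos by (simp add: algebra_simps)
qed

lemma ddiff2_recip:
  fixes p x y z :: real
  assumes "x < 1" "y < 1" "z < 1" "x \<noteq> y" "y \<noteq> z" "x \<noteq> z"
  defines "s \<equiv> 1 / (1 - x)" and "t \<equiv> 1 / (1 - y)" and "u \<equiv> 1 / (1 - z)"
    and "F \<equiv> \<lambda>x. p * (1 - x) powr (- (p + 1))"
  shows "ddiff2 F x y z = p * s * t * u * ddiff2 (\<lambda>s. s powr (p + 2)) s t u"
proof -
  let ?P = "\<lambda>s. s powr (p + 1)" and ?R = "\<lambda>s. s powr (p + 2)"
  have pos: "s > 0" "t > 0" "u > 0" "s \<noteq> t" "t \<noteq> u" "s \<noteq> u"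
    using assms by (auto simp: s_def t_def u_def divide_simps)
  have R: "?R r = r * ?P r" if "r > 0" for r
    using powr_mult_base[of r "p + 1"] that by (simp add: algebra_simps)
  \<comment> \<open>A factor s from the change of variable is absorbed by raising the exponent to p
    + 2; the same remainder \<open>?P t\<close> arises in both identities and cancels.\<close>
  have shift: "s * ddiff ?P s t = ddiff ?R s t - ?P t" "u * ddiff ?P t u = ddiff ?R t u - ?P t"
    using pos by (simp_all add: R ddiff_def divide_simps) (simp_all add: algebra_simps)
  have xz: "x - z = (s - u) / (s * u)" using assms by (simp add: s_def u_def divide_simps)
  have d: "ddiff F x y = p * s * t * ddiff ?P s t" "ddiff F y z = p * t * u * ddiff ?P t u"
    unfolding F_def s_def t_def u_def
    by (rule ddiff_recip[OF assms(1,2,4)], rule ddiff_recip[OF assms(2,3,5)])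
  have "ddiff2 F x y z = p * t * (s * ddiff ?P s t - u * ddiff ?P t u) * (s * u) / (s - u)"
    unfolding ddiff2_def d xz by (simp add: right_diff_distrib mult_ac)
  also have "\<dots> = p * s * t * u * ddiff2 ?R s t u"
    unfolding shift by (simp add: ddiff2_def)
  finally show ?thesis .
qed

text \<open>Coefficients of p (1 - t) ^ (- (p + 1)), the derivative of (1 - t) ^ (- p).\<close>

definition grad_coeff :: "real \<Rightarrow> nat \<Rightarrow> real" where
  "grad_coeff p k = p * neg_binomial (p + 1) k"

context
  fixes p :: real
  assumes p: "p > 0"
begin

lemma grad_coeff_nonneg: "0 \<le> grad_coeff p k"
  unfolding grad_coeff_def neg_binomial_def using p by (intro mult_nonneg_nonneg divide_nonneg_nonneg pochhammer_nonneg) auto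

lemma sums_grad_coeff: "\<bar>t\<bar> < 1 \<Longrightarrow> (\<lambda>k. grad_coeff p k * t ^ k) sums (p * (1 - t) powr (- (p + 1)))"
  using sums_mult[OF sums_neg_binomial[of t "p + 1"], of p] by (simp add: grad_coeff_def mult.assoc)

lemma summable_grad_coeff: "\<bar>t\<bar> < 1 \<Longrightarrow> summable (\<lambda>k. grad_coeff p k * t ^ k)"
  using sums_grad_coeff sums_summable by blast

lemma kernel2_grad_nonneg:
  assumes "0 \<le> x" "x < 1" "0 \<le> y" "y < 1"
  shows "0 \<le> kernel2 (grad_coeff p) x y"
  unfolding kernel2_def
  by (intro suminf_nonneg summable_kernel2[of _ "max x y", OF summable_grad_coeff]
      mult_nonneg_nonneg grad_coeff_nonneg mono_dd_nonneg) (use assms in auto)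

lemma kernel3_grad_nonneg:
  assumes "0 \<le> x" "x < 1" "0 \<le> y" "y < 1" "0 \<le> z" "z < 1"
  shows "0 \<le> kernel3 (grad_coeff p) x y z"
  unfolding kernel3_def
  by (intro suminf_nonneg summable_kernel3[of _ "max x (max y z)", OF summable_grad_coeff]
      mult_nonneg_nonneg grad_coeff_nonneg mono_dd2_nonneg) (use assms in auto)

text \<open>The conditions on k say that it is a lower bound for s, t and u. Both sides carry the
  same factor (s t u) ^ 2, so only \<open>ddiff2_powr_sq_le\<close> remains; its sign condition is
  read off from the nonnegative series of \<open>kernel3\<close>.\<close>

lemma kernel3_sq_le_distinct:
  assumes x: "0 \<le> x" "x < 1" "0 \<le> y" "y < 1" "0 \<le> z" "z < 1" and ne: "x \<noteq> y" "y \<noteq> z" "x \<noteq> z"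
    and k: "0 < k" "k * (1 - x) \<le> 1" "k * (1 - y) \<le> 1" "k * (1 - z) \<le> 1"
  shows "(2 * kernel3 (grad_coeff p) x y z)\<^sup>2 \<le> (p + 2)\<^sup>2 / (p * (p + 1)) * k powr (- p)
    * (kernel2 (grad_coeff p) x y * kernel2 (grad_coeff p) y z * kernel2 (grad_coeff p) z x)"
proof -
  define s t u where "s = 1 / (1 - x)" and "t = 1 / (1 - y)" and "u = 1 / (1 - z)"
  define q where "q = ddiff (\<lambda>s. s powr (p + 1))"
  define r where "r = ddiff2 (\<lambda>s. s powr (p + 2)) s t u"
  have K2: "kernel2 (grad_coeff p) a b = p * (1 / (1 - a)) * (1 / (1 - b)) * q (1 / (1 - a)) (1 / (1 - b))"
    if "0 \<le> a" "a < 1" "0 \<le> b" "b < 1" "a \<noteq> b" for a b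
    unfolding q_def
  proof (rule trans[OF kernel2_eq_ddiff[of _ "max a b", OF summable_grad_coeff] ddiff_recip])
    show "(\<lambda>k. grad_coeff p k * t ^ k) sums (p * (1 - t) powr (- (p + 1)))" if "\<bar>t\<bar> \<le> max a b" for t
      using that \<open>a < 1\<close> \<open>b < 1\<close> by (intro sums_grad_coeff) auto
  qed (use that in auto)
  have k2: "kernel2 (grad_coeff p) x y = p * s * t * q s t" "kernel2 (grad_coeff p) y z = p * t * u * q t u"
    "kernel2 (grad_coeff p) z x = p * u * s * q u s"
    unfolding s_def t_def u_def by (rule K2; use x ne in simp)+
  have k3: "kernel3 (grad_coeff p) x y z = p * s * t * u * r"
    unfolding r_def s_def t_def u_def
  proof (rule trans[OF kernel3_eq_ddiff2[of _ "max x (max y z)", OF summable_grad_coeff] ddiff2_recip])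
    show "(\<lambda>k. grad_coeff p k * t ^ k) sums (p * (1 - t) powr (- (p + 1)))" if "\<bar>t\<bar> \<le> max x (max y z)" for t
      using that x by (intro sums_grad_coeff) auto
  qed (use x ne in auto)
  have pos: "s > 0" "t > 0" "u > 0" using x by (auto simp: s_def t_def u_def)
  have "0 \<le> r"
  proof -
    have "0 < p * s * t * u" using pos p by simp
    then show ?thesis
      using kernel3_grad_nonneg[OF x] zero_le_mult_iff[of "p * s * t * u" r] unfolding k3 by linarith
  qed
  then have "(2 * r)\<^sup>2 \<le> (p + 2)\<^sup>2 / (p + 1) * k powr (- p) * (q s t * q t u * q u s)"
    unfolding r_def q_def
    by (intro ddiff2_powr_sq_le p) (use x ne k in \<open>auto simp: s_def t_def u_def field_simps\<close>)
  then have "(p * s * t * u)\<^sup>2 * (2 * r)\<^sup>2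
      \<le> (p * s * t * u)\<^sup>2 * ((p + 2)\<^sup>2 / (p + 1) * k powr (- p) * (q s t * q t u * q u s))"
    by (intro mult_left_mono) auto
  also have "\<dots> = (p + 2)\<^sup>2 / (p * (p + 1)) * k powr (- p)
      * ((p * s * t * q s t) * (p * t * u * q t u) * (p * u * s * q u s))"
  proof -
    have "(p * s * t * u)\<^sup>2 * (C / l * K * (a * b * c))
        = C / (p * l) * K * ((p * s * t * a) * (p * t * u * b) * (p * u * s * c))" for C l K a b c :: real
      using p by (cases "l = 0") (simp_all add: power2_eq_square)
    then show ?thesis .
  qed
  finally show ?thesis
    unfolding k2 k3 by (simp only: power_mult_distrib mult_ac)
qed

lemma kernel3_sq_le:
  assumes x: "0 \<le> x" "x < 1" "0 \<le> y" "y < 1" "0 \<le> z" "z < 1"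
    and k: "0 < k" "k * (1 - x) \<le> 1" "k * (1 - y) \<le> 1" "k * (1 - z) \<le> 1"
  shows "(2 * kernel3 (grad_coeff p) x y z)\<^sup>2 \<le> (p + 2)\<^sup>2 / (p * (p + 1)) * k powr (- p)
    * (kernel2 (grad_coeff p) x y * kernel2 (grad_coeff p) y z * kernel2 (grad_coeff p) z x)"
proof -
  define h where "h = (\<lambda>n. inverse (real (Suc n)))"
  have h: "h \<longlonglongrightarrow> 0" unfolding h_def by (rule LIMSEQ_inverse_real_of_nat)
  have hpos: "h n > 0" for n by (simp add: h_def)
  \<comment> \<open>Offsets 0, 1, 2 times h n make the three points eventually distinct; being
    nonnegative, they preserve both the lower bound 0 and the conditions on k.\<close>
  define w where "w c m n = c + m * h n" for c m :: real and n
  have w: "w c m \<longlonglongrightarrow> c" for c m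
    unfolding w_def using tendsto_add[OF tendsto_const tendsto_mult[OF tendsto_const h]] by simp
  have ne: "\<forall>\<^sub>F n in sequentially. w c m n \<noteq> w c' m' n" if "m \<noteq> m'" for c c' m m'
  proof (cases "c = c'")
    case True
    then show ?thesis using that hpos by (simp add: w_def less_imp_neq[symmetric])
  next
    case False
    have "(\<lambda>n. w c m n - w c' m' n) \<longlonglongrightarrow> c - c'" by (intro tendsto_diff w)
    then have "\<forall>\<^sub>F n in sequentially. w c m n - w c' m' n \<noteq> 0"
      using False by (intro tendsto_imp_eventually_ne) auto
    then show ?thesis by (rule eventually_mono) simp
  qed
  \<comment> \<open>Halfway to 1, leaving room for the perturbed points inside one disc of uniform
    convergence.\<close>
  define \<rho> where "\<rho> = (1 + max x (max y z)) / 2"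
  have \<rho>: "0 \<le> \<rho>" "\<rho> < 1" "x < \<rho>" "y < \<rho>" "z < \<rho>" using x by (auto simp: \<rho>_def)
  have lt: "\<forall>\<^sub>F n in sequentially. w c m n < \<rho>" if "c < \<rho>" for c m
    using order_tendstoD(2)[OF w that] .
  have ge: "c \<le> w c m n" if "0 \<le> m" for c m n using that hpos[of n] by (simp add: w_def)
  have k': "k * (1 - w c m n) \<le> 1" if "k * (1 - c) \<le> 1" "0 \<le> m" for c m n
    using ge[OF that(2), of c n] that k(1) by (smt (verit) mult_left_mono)
  have ev: "\<forall>\<^sub>F n in sequentially. w x 0 n < \<rho> \<and> w y 1 n < \<rho> \<and> w z 2 n < \<rho>"
    using \<rho> by (intro eventually_conj lt)
  then have ev': "\<forall>\<^sub>F n in sequentially. \<bar>w x 0 n\<bar> \<le> \<rho> \<and> \<bar>w y 1 n\<bar> \<le> \<rho> \<and> \<bar>w z 2 n\<bar> \<le> \<rho>"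
    by (rule eventually_mono) (simp add: abs_of_nonneg[OF order_trans[OF x(1) ge]]
        abs_of_nonneg[OF order_trans[OF x(3) ge]] abs_of_nonneg[OF order_trans[OF x(5) ge]])
  have lim2: "(\<lambda>n. kernel2 (grad_coeff p) (f n) (g n)) \<longlonglongrightarrow> kernel2 (grad_coeff p) c c'"
    if "f \<longlonglongrightarrow> c" "g \<longlonglongrightarrow> c'" "\<forall>\<^sub>F n in sequentially. \<bar>f n\<bar> \<le> \<rho> \<and> \<bar>g n\<bar> \<le> \<rho>" for f g c c'
    by (rule tendsto_kernel2[OF summable_grad_coeff \<rho>(1,2)]) (use that in auto)
  have lim3: "(\<lambda>n. kernel3 (grad_coeff p) (w x 0 n) (w y 1 n) (w z 2 n)) \<longlonglongrightarrow> kernel3 (grad_coeff p) x y z"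
    by (rule tendsto_kernel3[OF summable_grad_coeff \<rho>(1,2) w w w _ ev']) auto
  have ne01: "\<forall>\<^sub>F n in sequentially. w x 0 n \<noteq> w y 1 n"
    and ne12: "\<forall>\<^sub>F n in sequentially. w y 1 n \<noteq> w z 2 n"
    and ne02: "\<forall>\<^sub>F n in sequentially. w x 0 n \<noteq> w z 2 n" by (rule ne; simp)+
  show ?thesis
  proof (rule tendsto_le[OF trivial_limit_sequentially])
    show "(\<lambda>n. (2 * kernel3 (grad_coeff p) (w x 0 n) (w y 1 n) (w z 2 n))\<^sup>2)
        \<longlonglongrightarrow> (2 * kernel3 (grad_coeff p) x y z)\<^sup>2"
      by (intro tendsto_intros lim3)
    show "(\<lambda>n. (p + 2)\<^sup>2 / (p * (p + 1)) * k powr (- p)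
        * (kernel2 (grad_coeff p) (w x 0 n) (w y 1 n) * kernel2 (grad_coeff p) (w y 1 n) (w z 2 n)
          * kernel2 (grad_coeff p) (w z 2 n) (w x 0 n)))
      \<longlonglongrightarrow> (p + 2)\<^sup>2 / (p * (p + 1)) * k powr (- p)
        * (kernel2 (grad_coeff p) x y * kernel2 (grad_coeff p) y z * kernel2 (grad_coeff p) z x)"
      by (intro tendsto_mult tendsto_const lim2 w eventually_mono[OF ev']) auto
    show "\<forall>\<^sub>F n in sequentially. (2 * kernel3 (grad_coeff p) (w x 0 n) (w y 1 n) (w z 2 n))\<^sup>2
      \<le> (p + 2)\<^sup>2 / (p * (p + 1)) * k powr (- p)
        * (kernel2 (grad_coeff p) (w x 0 n) (w y 1 n) * kernel2 (grad_coeff p) (w y 1 n) (w z 2 n)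
          * kernel2 (grad_coeff p) (w z 2 n) (w x 0 n))"
      using ev ne01 ne12 ne02
    proof eventually_elim
      case (elim n)
      have "0 \<le> w x 0 n" "0 \<le> w y 1 n" "0 \<le> w z 2 n" using ge[of 0 x n] ge[of 1 y n] ge[of 2 z n] x by auto
      then show ?case
        by (intro kernel3_sq_le_distinct) (use elim \<rho>(2) k k' in auto)
    qed
  qed
qed

end

section \<open>From the kernel bound to the trilinear form\<close>

lemma weighted_trilinear_le:
  fixes K2 :: "'n::finite \<Rightarrow> 'n \<Rightarrow> real" and K3 :: "'n \<Rightarrow> 'n \<Rightarrow> 'n \<Rightarrow> real" and u v :: "real^'n^'n"
  assumes K2: "\<And>i j. 0 \<le> K2 i j"
    and K3: "\<And>i j l. \<bar>K3 i j l\<bar> \<le> M * (sqrt (K2 i j) * sqrt (K2 j l) * sqrt (K2 i l))"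
    and M: "0 \<le> M"
  shows "\<bar>\<Sum>i\<in>UNIV. \<Sum>l\<in>UNIV. (\<Sum>j\<in>UNIV. K3 i j l * (v $ i $ j * u $ j $ l + u $ i $ j * v $ j $ l)) * u $ i $ l\<bar>
    \<le> 2 * M * (\<Sum>i\<in>UNIV. \<Sum>j\<in>UNIV. K2 i j * (u $ i $ j)\<^sup>2) * sqrt (\<Sum>i\<in>UNIV. \<Sum>j\<in>UNIV. K2 i j * (v $ i $ j)\<^sup>2)"
proof -
  \<comment> \<open>Absolute values are needed because \<open>K3\<close> is bounded entry by entry;
    the sum of triple products is then the inner product of Z a ** Z b with Z c.\<close>
  define Z where "Z u = (\<chi> i j. sqrt (K2 i j) * \<bar>u $ i $ j\<bar>)" for u :: "real^'n^'n"
  have Z2: "(norm (Z u))\<^sup>2 = (\<Sum>i\<in>UNIV. \<Sum>j\<in>UNIV. K2 i j * (u $ i $ j)\<^sup>2)" for u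
    unfolding norm_matrix_sq using K2 by (simp add: Z_def power_mult_distrib)
  have tri: "(\<Sum>i\<in>UNIV. \<Sum>l\<in>UNIV. \<Sum>j\<in>UNIV. Z a $ i $ j * Z b $ j $ l * Z c $ i $ l)
      \<le> norm (Z a) * norm (Z b) * norm (Z c)" for a b c
  proof -
    have "(\<Sum>i\<in>UNIV. \<Sum>l\<in>UNIV. \<Sum>j\<in>UNIV. Z a $ i $ j * Z b $ j $ l * Z c $ i $ l) = (Z a ** Z b) \<bullet> Z c"
      by (simp add: inner_vec_def matrix_matrix_mult_def sum_distrib_right)
    also have "\<dots> \<le> norm (Z a ** Z b) * norm (Z c)" by (rule norm_cauchy_schwarz)
    also have "\<dots> \<le> norm (Z a) * norm (Z b) * norm (Z c)"
      by (intro mult_right_mono norm_matrix_mult_le) auto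
    finally show ?thesis .
  qed
  have bd: "\<bar>K3 i j l * (v $ i $ j * u $ j $ l + u $ i $ j * v $ j $ l) * u $ i $ l\<bar>
      \<le> M * (Z v $ i $ j * Z u $ j $ l * Z u $ i $ l + Z u $ i $ j * Z v $ j $ l * Z u $ i $ l)" for i j l
  proof -
    have "\<bar>v $ i $ j * u $ j $ l + u $ i $ j * v $ j $ l\<bar>
        \<le> \<bar>v $ i $ j\<bar> * \<bar>u $ j $ l\<bar> + \<bar>u $ i $ j\<bar> * \<bar>v $ j $ l\<bar>"
      by (metis abs_mult abs_triangle_ineq)
    then have "\<bar>K3 i j l * (v $ i $ j * u $ j $ l + u $ i $ j * v $ j $ l) * u $ i $ l\<bar>
      \<le> (M * (sqrt (K2 i j) * sqrt (K2 j l) * sqrt (K2 i l)))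
        * (\<bar>v $ i $ j\<bar> * \<bar>u $ j $ l\<bar> + \<bar>u $ i $ j\<bar> * \<bar>v $ j $ l\<bar>) * \<bar>u $ i $ l\<bar>"
      unfolding abs_mult using K2 M by (intro mult_mono K3) auto
    then show ?thesis by (simp add: Z_def algebra_simps)
  qed
  have "\<bar>\<Sum>i\<in>UNIV. \<Sum>l\<in>UNIV. (\<Sum>j\<in>UNIV. K3 i j l * (v $ i $ j * u $ j $ l + u $ i $ j * v $ j $ l)) * u $ i $ l\<bar>
      \<le> (\<Sum>i\<in>UNIV. \<Sum>l\<in>UNIV. \<Sum>j\<in>UNIV.
        \<bar>K3 i j l * (v $ i $ j * u $ j $ l + u $ i $ j * v $ j $ l) * u $ i $ l\<bar>)"
    unfolding sum_distrib_right
    by (intro order_trans[OF sum_abs] sum_mono order_trans[OF sum_abs]) auto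
  also have "\<dots> \<le> (\<Sum>i\<in>UNIV. \<Sum>l\<in>UNIV. \<Sum>j\<in>UNIV.
      M * (Z v $ i $ j * Z u $ j $ l * Z u $ i $ l + Z u $ i $ j * Z v $ j $ l * Z u $ i $ l))"
    by (intro sum_mono bd)
  also have "\<dots> = M * ((\<Sum>i\<in>UNIV. \<Sum>l\<in>UNIV. \<Sum>j\<in>UNIV. Z v $ i $ j * Z u $ j $ l * Z u $ i $ l)
      + (\<Sum>i\<in>UNIV. \<Sum>l\<in>UNIV. \<Sum>j\<in>UNIV. Z u $ i $ j * Z v $ j $ l * Z u $ i $ l))"
    by (simp add: sum_distrib_left sum.distrib distrib_left)
  also have "\<dots> \<le> M * (norm (Z v) * norm (Z u) * norm (Z u) + norm (Z u) * norm (Z v) * norm (Z u))"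
    by (intro mult_left_mono add_mono tri M)
  also have "\<dots> = 2 * M * (norm (Z u))\<^sup>2 * sqrt ((norm (Z v))\<^sup>2)"
    by (simp add: power2_eq_square)
  finally show ?thesis unfolding Z2 .
qed

section \<open>The gradient of the trace series as a symmetric matrix\<close>

lemma inner_transpose: "transpose A \<bullet> transpose B = A \<bullet> (B :: real^'n::finite^'m::finite)"
  by (simp add: inner_vec_def transpose_def) (rule sum.swap)

text \<open>The adjoint of \<open>mat_of\<close>, that is, the orthogonal projection onto symmetric
  matrices. With it the matrix series define elements of \<open>symmat\<close> without separate
  symmetry proofs.\<close>

definition sym_part :: "real^'n::finite^'n \<Rightarrow> 'n symmat" where
  "sym_part M = Abs_symmat ((1/2) *\<^sub>R (M + transpose M))"

lemma mat_of_sym_part: "mat_of (sym_part M) = (1/2) *\<^sub>R (M + transpose M)"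
  unfolding sym_part_def
  by (rule mat_of_Abs) (simp add: transpose_def vec_eq_iff add.commute)

lemma inner_sym_part: "sym_part M \<bullet> U = M \<bullet> mat_of U"
  using inner_transpose[of M "mat_of U"]
  by (simp add: inner_symmat_eq mat_of_sym_part inner_add_left)

lemma bounded_linear_sym_part: "bounded_linear sym_part"
  unfolding linear_conv_bounded_linear[symmetric]
  by (rule linearI)
    (rule mat_of_eqI, simp add: mat_of_sym_part transpose_def vec_eq_iff algebra_simps)+

lemma bounded_linear_mat_of: "bounded_linear mat_of"
  unfolding linear_conv_bounded_linear[symmetric] by (rule linearI) simp_all

lemma mat_power_add: "mat_power A (i + j) = mat_power A i ** mat_power A j"
  by (induction i) (simp_all add: matrix_mul_assoc)

lemma transpose_mat_power: "transpose A = A \<Longrightarrow> transpose (mat_power A k) = mat_power A k"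
proof (induction k)
  case (Suc k)
  have "mat_power A k ** A = A ** mat_power A k"
    using mat_power_add[of A k 1] mat_power_add[of A 1 k] by (simp add: add.commute)
  with Suc show ?case by (simp add: matrix_transpose_mul)
qed simp

text \<open>Under the trace the k words of \<open>dpower A U k\<close> coincide, by cyclicity. The
  prefix A ^ m is there for the induction, which moves factors A into it.\<close>

lemma trace_dpower: "trace (mat_power A m ** dpower A U k) = real k * trace (mat_power A (m + k - 1) ** U)"
proof (induction k arbitrary: m)
  case (Suc k)
  have "trace (mat_power A m ** (U ** mat_power A k)) = trace (mat_power A k ** mat_power A m ** U)"
    by (subst matrix_mul_assoc, subst trace_mul_sym, simp add: matrix_mul_assoc)
  also have "\<dots> = trace (mat_power A (m + k) ** U)"
    by (simp add: mat_power_add[symmetric] add.commute)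
  finally have 1: "trace (mat_power A m ** (U ** mat_power A k)) = trace (mat_power A (m + k) ** U)" .
  have "mat_power A m ** A = mat_power A (Suc m)"
    using mat_power_add[of A m 1] by simp
  then have "trace (mat_power A m ** (A ** dpower A U k)) = real k * trace (mat_power A (m + k) ** U)"
    using Suc[of "Suc m"] by (simp only: matrix_mul_assoc) simp
  with 1 show ?case
    by (simp add: matrix_mult.add_right trace_add algebra_simps)
qed (simp add: matrix_mult.zero_right trace_def)

lemma bounded_linear_trace: "bounded_linear (trace :: real^'n::finite^'n \<Rightarrow> real)"
  unfolding linear_conv_bounded_linear[symmetric]
  by (rule linearI) (simp_all add: trace_add, simp add: trace_def sum_distrib_left)

text \<open>The trace removes the noncommutativity of the first derivative, so that it is the scalar
  derivative of (1 - t) ^ (- p) evaluated at A and paired with U.\<close>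

lemma trace_dseries_neg_binomial:
  assumes A: "transpose A = A" "A \<in> contractions \<rho>" and \<rho>: "0 \<le> \<rho>" "\<rho> < 1" and p: "0 < p"
  shows "trace (dseries (neg_binomial p) A U) = mat_series (grad_coeff p) A \<bullet> U"
proof -
  have nb: "summable (\<lambda>k. neg_binomial p k * x ^ k)" if "\<bar>x\<bar> < 1" for x :: real
    using sums_neg_binomial[OF that] sums_summable by blast
  have t: "trace (neg_binomial p k *\<^sub>R dpower A U k) = neg_binomial p k * (real k * trace (mat_power A (k - 1) ** U))" for k
    using trace_dpower[of A 0 U k] by (simp add: linear_scale[OF bounded_linear.linear[OF bounded_linear_trace]])
  have sd: "summable (\<lambda>k. neg_binomial p k *\<^sub>R dpower A U k)"
    by (rule summable_dseries[OF nb \<rho> A(2)])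
  have "trace (dseries (neg_binomial p) A U) = (\<Sum>k. trace (neg_binomial p k *\<^sub>R dpower A U k))"
    unfolding dseries_def by (rule bounded_linear.suminf[OF bounded_linear_trace sd])
  \<comment> \<open>The term k = 0 vanishes; the shift prepares
    \<open>neg_binomial_Suc\<close>.\<close>
  also have "\<dots> = (\<Sum>k. trace (neg_binomial p (Suc k) *\<^sub>R dpower A U (Suc k)))"
    using suminf_split_head[OF bounded_linear.summable[OF bounded_linear_trace sd]] unfolding t by simp
  also have "\<dots> = (\<Sum>k. (grad_coeff p k *\<^sub>R mat_power A k) \<bullet> U)"
  proof (rule suminf_cong)
    fix k
    have "trace (neg_binomial p (Suc k) *\<^sub>R dpower A U (Suc k))
        = neg_binomial p (Suc k) * real (Suc k) * trace (mat_power A k ** U)"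
      unfolding t by simp
    also have "\<dots> = grad_coeff p k * (mat_power A k \<bullet> U)"
      unfolding neg_binomial_Suc grad_coeff_def by (simp add: trace_mult_eq_inner transpose_mat_power A(1))
    finally show "trace (neg_binomial p (Suc k) *\<^sub>R dpower A U (Suc k)) = (grad_coeff p k *\<^sub>R mat_power A k) \<bullet> U"
      by simp
  qed
  also have "\<dots> = mat_series (grad_coeff p) A \<bullet> U"
    unfolding mat_series_def
    by (rule bounded_linear.suminf[OF bounded_linear_inner_left summable_mat_series[OF summable_grad_coeff[OF p] \<rho> A(2)], symmetric])
  finally show ?thesis .
qed

section \<open>Positive definite matrices and traces of their powers\<close>

lemma eigenvalue_quadratic_form:
  fixes Q :: "real^'n::finite^'n"
  assumes Q: "orthogonal_matrix Q" and A: "A = Q ** diag_mat d ** transpose Q"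
  shows "norm (column i Q) = 1" "column i Q \<bullet> (A *v column i Q) = d $ i"
proof -
  show n: "norm (column i Q) = 1" using Q by (simp add: orthogonal_matrix_orthonormal_columns)
  have "A ** Q = Q ** diag_mat d"
    unfolding A by (simp add: matrix_mul_assoc[symmetric] orthogonal_cancel[OF Q])
  then have "A *v column i Q = column i (Q ** diag_mat d)"
    by (metis matrix_vector_mul_assoc matrix_vector_mult_basis)
  also have "\<dots> = d $ i *\<^sub>R column i Q"
    by (simp add: vec_eq_iff column_def diag_mat_mult_entry mult.commute)
  finally show "column i Q \<bullet> (A *v column i Q) = d $ i"
    using n by (simp add: norm_eq_1)
qed

text \<open>Cauchy-Schwarz for A and the rank-one matrix with entries v i * v j.\<close>

lemma abs_quadratic_form_le: "\<bar>v \<bullet> ((A :: real^'n::finite^'n) *v v)\<bar> \<le> norm A * (norm v)\<^sup>2"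
proof -
  define V :: "real^'n^'n" where "V = (\<chi> i j. v $ i * v $ j)"
  have "v \<bullet> (A *v v) = A \<bullet> V"
    by (simp add: V_def inner_vec_def matrix_vector_mult_def sum_distrib_left mult_ac)
  moreover have "(norm V)\<^sup>2 = ((norm v)\<^sup>2)\<^sup>2"
  proof -
    have "(norm V)\<^sup>2 = (\<Sum>i\<in>UNIV. \<Sum>j\<in>UNIV. (v $ i)\<^sup>2 * (v $ j)\<^sup>2)"
      unfolding norm_matrix_sq by (simp add: V_def power_mult_distrib)
    also have "\<dots> = (\<Sum>i\<in>UNIV. (v $ i)\<^sup>2) * (\<Sum>j\<in>UNIV. (v $ j)\<^sup>2)" by (simp add: sum_product)
    also have "\<dots> = ((norm v)\<^sup>2)\<^sup>2"
      unfolding power2_norm_eq_inner by (simp add: inner_vec_def power2_eq_square)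
    finally show ?thesis .
  qed
  then have "norm V = (norm v)\<^sup>2" by (rule power2_eq_imp_eq) auto
  ultimately show ?thesis using Cauchy_Schwarz_ineq2[of A V] by simp
qed

lemma symmat_eigendecomposition:
  fixes X :: "'n::finite symmat"
  obtains Q d where "orthogonal_matrix Q" "mat_of X = Q ** diag_mat d ** transpose Q"
    "\<And>i. \<bar>d $ i\<bar> \<le> norm X"
    "X \<in> pos_def_mats \<Longrightarrow> (\<And>i. 0 < d $ i)"
    "\<And>\<alpha>. X \<preceq>\<^sub>L \<alpha> *\<^sub>R id_symmat \<Longrightarrow> (\<And>i. d $ i \<le> \<alpha>)"
proof -
  obtain Q d where Q: "orthogonal_matrix Q" and X: "mat_of X = Q ** diag_mat d ** transpose Q"
    using symmetric_matrix_eigendecomposition[of "mat_of X"] by auto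
  note eig = eigenvalue_quadratic_form[OF Q X]
  have "\<bar>d $ i\<bar> \<le> norm X" for i
    using abs_quadratic_form_le[of "column i Q" "mat_of X"] eig[of i] by (simp add: norm_symmat_eq)
  moreover have "0 < d $ i" if "X \<in> pos_def_mats" for i
  proof -
    have "column i Q \<noteq> 0" using eig(1)[of i] by auto
    then have "0 < column i Q \<bullet> (mat_of (X - 0) *v column i Q)"
      using that unfolding pos_def_mats_def loewner_less_def by blast
    then show ?thesis using eig(2)[of i] by simp
  qed
  moreover have "d $ i \<le> \<alpha>" if "X \<preceq>\<^sub>L \<alpha> *\<^sub>R id_symmat" for \<alpha> i
  proof -
    have "0 \<le> column i Q \<bullet> (mat_of (\<alpha> *\<^sub>R id_symmat - X) *v column i Q)"
      using that unfolding loewner_le_def by blast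
    also have "\<dots> = \<alpha> * (column i Q \<bullet> column i Q) - column i Q \<bullet> (mat_of X *v column i Q)"
      by (simp add: matrix_vector_mult_diff_rdistrib inner_diff_right scaleR_matrix_vector_assoc[symmetric])
    finally show ?thesis using eig[of i] by (simp add: norm_eq_1)
  qed
  ultimately show thesis using that[OF Q X] by blast
qed

lemma pos_def_mats_quadratic_form:
  "X \<in> pos_def_mats \<longleftrightarrow> (\<forall>v. v \<noteq> 0 \<longrightarrow> 0 < v \<bullet> (mat_of X *v v))"
  by (simp add: pos_def_mats_def loewner_less_def)

lemma convex_pos_def_mats: "convex (pos_def_mats :: 'n::finite symmat set)"
proof (rule convexI)
  fix X Y :: "'n symmat" and s t :: real
  assume XY: "X \<in> pos_def_mats" "Y \<in> pos_def_mats" and st: "0 \<le> s" "0 \<le> t" "s + t = 1"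
  show "s *\<^sub>R X + t *\<^sub>R Y \<in> pos_def_mats"
    unfolding pos_def_mats_quadratic_form
  proof (intro allI impI)
    fix v :: "real^'n" assume "v \<noteq> 0"
    then have q: "0 < v \<bullet> (mat_of X *v v)" "0 < v \<bullet> (mat_of Y *v v)"
      using XY by (auto simp: pos_def_mats_quadratic_form)
    have "v \<bullet> (mat_of (s *\<^sub>R X + t *\<^sub>R Y) *v v) = s * (v \<bullet> (mat_of X *v v)) + t * (v \<bullet> (mat_of Y *v v))"
      by (simp add: matrix_vector_mult_add_rdistrib inner_add_right scaleR_matrix_vector_assoc[symmetric])
    moreover have "0 < s * (v \<bullet> (mat_of X *v v)) + t * (v \<bullet> (mat_of Y *v v))"
    proof (cases "s = 0")
      case True with st q show ?thesis by simp
    next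
      case False with st q show ?thesis by (intro add_pos_nonneg) auto
    qed
    ultimately show "0 < v \<bullet> (mat_of (s *\<^sub>R X + t *\<^sub>R Y) *v v)" by simp
  qed
qed

lemma open_pos_def_mats: "open (pos_def_mats :: 'n::finite symmat set)"
proof (rule openI)
  fix X :: "'n symmat" assume X: "X \<in> pos_def_mats"
  obtain Q d where Q: "orthogonal_matrix Q" and d: "mat_of X = Q ** diag_mat d ** transpose Q" "\<And>i. 0 < d $ i"
    using symmat_eigendecomposition[of X] X by metis
  \<comment> \<open>The least eigenvalue serves as the radius of a ball of positive definite
    matrices.\<close>
  define l where "l = Min (range (($) d))"
  have l: "l \<le> d $ i" for i unfolding l_def by simp
  have lpos: "l > 0" unfolding l_def using d(2) by (subst Min_gr_iff) auto
  have low: "l * (norm v)\<^sup>2 \<le> v \<bullet> (mat_of X *v v)" for v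
  proof -
    define w where "w = transpose Q *v v"
    have "w \<bullet> w = v \<bullet> (Q *v w)" unfolding inner_matrix_vector_mult_right w_def ..
    then have nw: "norm w = norm v"
      unfolding w_def matrix_vector_mul_assoc orthogonal_cancel(2)[OF Q]
      by (simp add: norm_eq_sqrt_inner)
    have "v \<bullet> (mat_of X *v v) = v \<bullet> (Q *v (diag_mat d *v w))"
      unfolding d(1) w_def matrix_vector_mul_assoc matrix_mul_assoc ..
    also have "\<dots> = w \<bullet> (diag_mat d *v w)"
      unfolding inner_matrix_vector_mult_right[of v Q] w_def ..
    also have "\<dots> = (\<Sum>i\<in>UNIV. d $ i * (w $ i)\<^sup>2)"
      by (simp add: inner_vec_def matrix_vector_mult_def diag_mat_def if_distrib[where f="\<lambda>x. x * _"]
          cong: if_cong) (simp add: power2_eq_square mult_ac)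
    also have "\<dots> \<ge> (\<Sum>i\<in>UNIV. l * (w $ i)\<^sup>2)" by (intro sum_mono mult_right_mono l) auto
    also have "(\<Sum>i\<in>UNIV. l * (w $ i)\<^sup>2) = l * (norm w)\<^sup>2"
      unfolding power2_norm_eq_inner by (simp add: inner_vec_def sum_distrib_left power2_eq_square)
    finally show ?thesis by (simp add: nw)
  qed
  have "Y \<in> pos_def_mats" if "dist X Y < l" for Y
    unfolding pos_def_mats_quadratic_form
  proof (intro allI impI)
    fix v :: "real^'n" assume v: "v \<noteq> 0"
    have "\<bar>v \<bullet> (mat_of (X - Y) *v v)\<bar> \<le> norm (X - Y) * (norm v)\<^sup>2"
      using abs_quadratic_form_le[of v "mat_of (X - Y)"] by (simp add: norm_symmat_eq)
    also have "\<dots> < l * (norm v)\<^sup>2" using that v by (simp add: dist_norm)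
    also have "\<dots> \<le> v \<bullet> (mat_of X *v v)" by (rule low)
    finally show "0 < v \<bullet> (mat_of Y *v v)"
      by (simp add: matrix_vector_mult_diff_rdistrib inner_diff_right)
  qed
  then show "\<exists>e>0. ball X e \<subseteq> pos_def_mats" using lpos by (intro exI[of _ l]) auto
qed

lemma mat_powr_eq:
  assumes "orthogonal_matrix Q" "mat_of X = Q ** diag_mat d ** transpose Q"
  shows "mat_powr X r = Q ** diag_mat (\<chi> i. d $ i powr r) ** transpose Q"
  unfolding mat_powr_def
proof (rule the_equality)
  show "\<exists>P e. orthogonal_matrix P \<and> mat_of X = P ** diag_mat e ** transpose P \<and>
      Q ** diag_mat (\<chi> i. d $ i powr r) ** transpose Q = P ** diag_mat (\<chi> i. e $ i powr r) ** transpose P"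
    using assms by blast
  fix Y
  assume "\<exists>P e. orthogonal_matrix P \<and> mat_of X = P ** diag_mat e ** transpose P \<and>
      Y = P ** diag_mat (\<chi> i. e $ i powr r) ** transpose P"
  then show "Y = Q ** diag_mat (\<chi> i. d $ i powr r) ** transpose Q"
    using eigendecomposition_powr_unique assms by metis
qed

lemma trace_mat_powr:
  assumes "orthogonal_matrix Q" "mat_of X = Q ** diag_mat d ** transpose Q"
  shows "trace (mat_powr X r) = (\<Sum>i\<in>UNIV. d $ i powr r)"
  unfolding mat_powr_eq[OF assms]
  using trace_in_basis[OF assms(1), of "Q ** diag_mat (\<chi> i. d $ i powr r) ** transpose Q"]
  by (simp add: in_basis_diag[OF assms(1)]) (simp add: trace_def diag_mat_def)

text \<open>With \<open>X = \<beta> (I - E)\<close>, the power \<open>X ^ - p\<close> is \<open>\<beta> ^ - p\<close> times the binomial series of \<open>E\<close>.\<close>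

definition defect :: "real \<Rightarrow> 'n::finite symmat \<Rightarrow> real^'n^'n" where
  "defect \<beta> X = mat 1 - (1 / \<beta>) *\<^sub>R mat_of X"

lemma defect_eigendecomposition:
  assumes "orthogonal_matrix Q" "mat_of X = Q ** diag_mat d ** transpose Q"
  shows "defect \<beta> X = Q ** diag_mat (\<chi> i. 1 - d $ i / \<beta>) ** transpose Q"
proof -
  have "diag_mat (\<chi> i. 1 - d $ i / \<beta>) = mat 1 - (1 / \<beta>) *\<^sub>R diag_mat d"
    by (simp add: vec_eq_iff diag_mat_def mat_def)
  then show ?thesis
    using orthogonal_cancel(2)[OF assms(1)]
    by (simp add: defect_def assms(2) matrix_mult.diff_left matrix_mult.diff_right
        matrix_mult.scaleR_left matrix_mult.scaleR_right)
qed

lemma transpose_defect: "transpose (defect \<beta> X) = defect \<beta> X"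
proof -
  have "transpose (mat_of X) $ i $ j = mat_of X $ i $ j" for i j by simp
  then have "mat_of X $ j $ i = mat_of X $ i $ j" for i j by (simp only: transpose_def vec_lambda_beta)
  then show ?thesis by (simp add: defect_def transpose_def mat_def vec_eq_iff)
qed

lemma has_derivative_defect:
  "(defect \<beta> has_derivative (\<lambda>V. - (1 / \<beta>) *\<^sub>R mat_of V)) (at X within S)"
  unfolding defect_def[abs_def]
  by (rule has_derivative_eq_rhs[OF has_derivative_diff[OF has_derivative_const
        has_derivative_scaleR_right[OF bounded_linear_imp_has_derivative[OF bounded_linear_mat_of]]]]) simp

text \<open>The trace splits into scalar binomial series at 1 - d i / \<beta>; the condition on
  \<beta> puts these points inside the unit interval.\<close>

lemma trace_mat_powr_eq_series:
  fixes X :: "'n::finite symmat"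
  assumes X: "X \<in> pos_def_mats" and \<beta>: "norm X < \<beta>"
    and \<rho>: "defect \<beta> X \<in> contractions \<rho>" "0 \<le> \<rho>" "\<rho> < 1"
  shows "trace (mat_powr X (- p)) = \<beta> powr (- p) * trace (mat_series (neg_binomial p) (defect \<beta> X))"
proof -
  obtain Q d where Q: "orthogonal_matrix Q" and d: "mat_of X = Q ** diag_mat d ** transpose Q"
    and b: "\<And>i. \<bar>d $ i\<bar> \<le> norm X" and pos: "\<And>i. 0 < d $ i"
    using symmat_eigendecomposition[of X] X by metis
  define e :: "real^'n" where "e = (\<chi> i. 1 - d $ i / \<beta>)"
  have \<beta>0: "\<beta> > 0" using \<beta> norm_ge_zero[of X] by linarith
  have D: "defect \<beta> X = Q ** diag_mat e ** transpose Q"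
    unfolding e_def by (rule defect_eigendecomposition[OF Q d])
  have e: "\<bar>e $ i\<bar> < 1" for i
    using b[of i] pos[of i] \<beta> \<beta>0 by (simp add: e_def abs_if divide_simps)
  have nb: "summable (\<lambda>k. neg_binomial p k * x ^ k)" if "\<bar>x\<bar> < 1" for x :: real
    using sums_neg_binomial[OF that] sums_summable by blast
  have tp: "trace (neg_binomial p k *\<^sub>R mat_power (defect \<beta> X) k) = (\<Sum>i\<in>UNIV. neg_binomial p k * e $ i ^ k)" for k
  proof -
    have "trace (mat_power (defect \<beta> X) k) = (\<Sum>i\<in>UNIV. e $ i ^ k)"
      using trace_in_basis[OF Q, of "mat_power (defect \<beta> X) k"]
      by (simp add: in_basis_mat_power[OF Q D]) (simp add: trace_def diag_mat_def)
    then show ?thesis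
      by (simp add: linear_scale[OF bounded_linear.linear[OF bounded_linear_trace]] sum_distrib_left)
  qed
  have "trace (mat_series (neg_binomial p) (defect \<beta> X))
      = (\<Sum>k. trace (neg_binomial p k *\<^sub>R mat_power (defect \<beta> X) k))"
    unfolding mat_series_def
    by (rule bounded_linear.suminf[OF bounded_linear_trace summable_mat_series[OF nb \<rho>(2,3,1)]])
  also have "\<dots> = (\<Sum>i\<in>UNIV. \<Sum>k. neg_binomial p k * e $ i ^ k)"
    unfolding tp by (intro suminf_sum nb e)
  also have "\<dots> = (\<Sum>i\<in>UNIV. (d $ i / \<beta>) powr (- p))"
    using sums_unique[OF sums_neg_binomial[OF e]] by (simp add: e_def)
  finally have "\<beta> powr (- p) * trace (mat_series (neg_binomial p) (defect \<beta> X))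
      = (\<Sum>i\<in>UNIV. \<beta> powr (- p) * (d $ i / \<beta>) powr (- p))" by (simp add: sum_distrib_left)
  also have "\<dots> = (\<Sum>i\<in>UNIV. d $ i powr (- p))"
    using pos \<beta>0 by (intro sum.cong refl) (simp flip: powr_mult add: less_imp_le)
  finally show ?thesis using trace_mat_powr[OF Q d] by simp
qed

section \<open>Derivatives of the trace power in an eigenbasis\<close>

text \<open>The numbers \<open>e i\<close> are the eigenvalues of \<open>defect \<beta> X\<close>,
  so \<beta> (1 - e i) are those of X. The expansion point is chosen for the given X; no single one
  is used for the whole cone.\<close>

lemma trace_power_calculus:
  fixes X :: "'n::finite symmat"
  assumes p: "0 < p" and X: "X \<in> pos_def_mats"
  defines "f \<equiv> \<lambda>X :: 'n symmat. trace (mat_powr X (- p))"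
  obtains Q :: "real^'n^'n" and e :: "'n \<Rightarrow> real" and \<beta> :: real where
    "GDERIV f X :> grad f X"
    "(grad f has_derivative blinfun_apply (hessian f X)) (at X)"
    "hessian f differentiable (at X)"
    "0 < \<beta>" "\<And>i. 0 \<le> e i" "\<And>i. e i < 1"
    "\<And>\<alpha> i. X \<preceq>\<^sub>L \<alpha> *\<^sub>R id_symmat \<Longrightarrow> \<beta> * (1 - e i) \<le> \<alpha>"
    "\<And>U. blinfun_apply (hessian f X) U \<bullet> U = (\<Sum>i\<in>UNIV. \<Sum>j\<in>UNIV.
      \<beta> powr (- p) / \<beta>\<^sup>2 * kernel2 (grad_coeff p) (e i) (e j) * (in_basis Q (mat_of U) $ i $ j)\<^sup>2)"
    "\<And>V U. blinfun_apply (third_deriv f X V) U \<bullet> U = - (\<Sum>i\<in>UNIV. \<Sum>l\<in>UNIV. (\<Sum>j\<in>UNIV.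
      \<beta> powr (- p) / \<beta> ^ 3 * kernel3 (grad_coeff p) (e i) (e j) (e l)
        * (in_basis Q (mat_of V) $ i $ j * in_basis Q (mat_of U) $ j $ l
          + in_basis Q (mat_of U) $ i $ j * in_basis Q (mat_of V) $ j $ l))
        * in_basis Q (mat_of U) $ i $ l)"
proof -
  obtain Q d where Q: "orthogonal_matrix Q" and d: "mat_of X = Q ** diag_mat d ** transpose Q"
    and b: "\<And>i. \<bar>d $ i\<bar> \<le> norm X" and pos: "\<And>i. 0 < d $ i"
    and up: "\<And>\<alpha> i. X \<preceq>\<^sub>L \<alpha> *\<^sub>R id_symmat \<Longrightarrow> d $ i \<le> \<alpha>"
    using symmat_eigendecomposition[of X] X by metis
  \<comment> \<open>The extra 1 lets the same \<beta> serve for all Y within distance 1 of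
    X.\<close>
  define \<beta> where "\<beta> = norm X + 1"
  define e where "e i = 1 - d $ i / \<beta>" for i
  have \<beta>: "\<beta> > 0" by (simp add: \<beta>_def add_nonneg_pos)
  have de: "d $ i = \<beta> * (1 - e i)" for i using \<beta> by (simp add: e_def)
  have e: "0 \<le> e i" "e i < 1" for i
    using b[of i] pos[of i] \<beta> by (simp_all add: e_def \<beta>_def divide_simps)
  define r where "r = Max (range e)"
  have er: "e i \<le> r" for i unfolding r_def by simp
  have r: "0 \<le> r" "r < 1"
    using order_trans[OF e(1) er] unfolding r_def using e(2) by auto
  have E: "defect \<beta> X = Q ** diag_mat (\<chi> i. e i) ** transpose Q"
    unfolding e_def by (rule defect_eigendecomposition[OF Q d])
  have abs_e: "\<bar>(\<chi> i. e i) $ i\<bar> \<le> r" for i using e(1)[of i] er[of i] by simp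
  \<comment> \<open>Half of the gap between the largest eigenvalue r and 1 is reserved for
    perturbation; the radius of \<open>N\<close> has a factor \<beta> because \<open>defect\<close>
    divides distances by it.\<close>
  define \<rho> where "\<rho> = r + (1 - r) / 2"
  have \<rho>: "0 \<le> \<rho>" "\<rho> < 1" using r by (auto simp: \<rho>_def field_simps)
  define N where "N = ball X (min 1 (\<beta> * ((1 - r) / 2))) \<inter> pos_def_mats"
  have N: "open N" "X \<in> N"
    using open_pos_def_mats X r \<beta> by (auto simp: N_def)
  have con: "defect \<beta> Y \<in> contractions \<rho>" if "Y \<in> N" for Y
    unfolding \<rho>_def
  proof (rule contractions_perturb)
    show "defect \<beta> X \<in> contractions r" by (rule contractionsI_eigen[OF Q E abs_e])
    have "defect \<beta> Y - defect \<beta> X = (1 / \<beta>) *\<^sub>R mat_of (X - Y)"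
      by (simp add: defect_def scaleR_diff_right)
    then have "norm (defect \<beta> Y - defect \<beta> X) = dist X Y / \<beta>"
      using \<beta> by (simp add: dist_norm norm_symmat_eq)
    moreover have "dist X Y / \<beta> \<le> (1 - r) / 2"
      using that \<beta> by (simp add: N_def pos_divide_le_eq mult.commute)
    ultimately show "norm (defect \<beta> Y - defect \<beta> X) \<le> (1 - r) / 2" by simp
  qed
  have nY: "norm Y < \<beta>" "Y \<in> pos_def_mats" if "Y \<in> N" for Y
    using that norm_triangle_sub[of Y X] by (auto simp: N_def \<beta>_def dist_norm norm_minus_commute)
  \<comment> \<open>\<open>defect\<close> maps the open set \<open>N\<close> into
    \<open>contractions \<rho>\<close>, which turns derivatives within the latter into derivatives
    at Y.\<close>
  have chain: "((\<lambda>Y. F (defect \<beta> Y)) has_derivative (\<lambda>V. F' (- (1 / \<beta>) *\<^sub>R mat_of V))) (at Y)"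
    if "Y \<in> N" and "(F has_derivative F') (at (defect \<beta> Y) within contractions \<rho>)"
    for Y and F :: "real^'n^'n \<Rightarrow> real^'n^'n" and F'
  proof -
    have "defect \<beta> ` N \<subseteq> contractions \<rho>" using con by blast
    then have "((\<lambda>Y. F (defect \<beta> Y)) has_derivative (\<lambda>V. F' (- (1 / \<beta>) *\<^sub>R mat_of V))) (at Y within N)"
      by (intro has_derivative_in_compose[OF has_derivative_defect] has_derivative_subset[OF that(2)])
    then show ?thesis using at_within_open[OF that(1) N(1)] by simp
  qed
  have nb: "summable (\<lambda>k. neg_binomial p k * x ^ k)" if "\<bar>x\<bar> < 1" for x :: real
    using sums_neg_binomial[OF that] sums_summable by blast
  note gc = summable_grad_coeff[OF p]
  \<comment> \<open>Prefactor of the series times the first chain-rule factor; every further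
    derivative contributes another - 1 / \<beta>, which gives the signs in \<open>c1\<close> and
    \<open>c2\<close>.\<close>
  define c where "c = \<beta> powr (- p) * - (1 / \<beta>)"
  define G where "G Y = sym_part (c *\<^sub>R mat_series (grad_coeff p) (defect \<beta> Y))" for Y :: "'n symmat"
  define H where "H Y U = sym_part (c *\<^sub>R dseries (grad_coeff p) (defect \<beta> Y) (- (1 / \<beta>) *\<^sub>R mat_of U))"
    for Y U :: "'n symmat"
  define T where "T Y V U = sym_part (c *\<^sub>R ddseries (grad_coeff p) (defect \<beta> Y)
      (- (1 / \<beta>) *\<^sub>R mat_of V) (- (1 / \<beta>) *\<^sub>R mat_of U))" for Y V U :: "'n symmat"
  have dG: "GDERIV f Y :> G Y" if Y: "Y \<in> N" for Y
  proof -
    have "((\<lambda>Y. \<beta> powr (- p) * trace (mat_series (neg_binomial p) (defect \<beta> Y))) has_derivative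
        (\<lambda>U. \<beta> powr (- p) * trace (dseries (neg_binomial p) (defect \<beta> Y) (- (1 / \<beta>) *\<^sub>R mat_of U)))) (at Y)"
      by (intro has_derivative_mult_right bounded_linear.has_derivative[OF bounded_linear_trace]
          chain[OF Y] has_derivative_mat_series[OF nb \<rho> con[OF Y]])
    also have "(\<lambda>U. \<beta> powr (- p) * trace (dseries (neg_binomial p) (defect \<beta> Y) (- (1 / \<beta>) *\<^sub>R mat_of U)))
        = (\<lambda>U. U \<bullet> G Y)"
      unfolding trace_dseries_neg_binomial[OF transpose_defect con[OF Y] \<rho> p]
      by (simp add: fun_eq_iff G_def inner_commute[of _ "sym_part _"] inner_sym_part c_def)
    finally have "(f has_derivative (\<lambda>U. U \<bullet> G Y)) (at Y)"
    proof (rule has_derivative_transform_within_open[OF _ N(1) Y])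
      fix Z assume "Z \<in> N"
      then show "\<beta> powr (- p) * trace (mat_series (neg_binomial p) (defect \<beta> Z)) = f Z"
        unfolding f_def using trace_mat_powr_eq_series[OF nY(2) nY(1) con \<rho>] by simp
    qed
    then show ?thesis unfolding gderiv_def .
  qed
  have dH: "(G has_derivative H Y) (at Y)" if Y: "Y \<in> N" for Y
    unfolding G_def[abs_def] H_def
    by (intro bounded_linear.has_derivative[OF bounded_linear_sym_part] has_derivative_scaleR_right
        chain[OF Y] has_derivative_mat_series[OF gc \<rho> con[OF Y]])
  have dT: "((\<lambda>Z. H Z U) has_derivative (\<lambda>V. T Y V U)) (at Y)" if Y: "Y \<in> N" for Y U
    unfolding H_def[abs_def] T_def
    by (intro bounded_linear.has_derivative[OF bounded_linear_sym_part] has_derivative_scaleR_right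
        chain[OF Y] has_derivative_dseries[OF gc \<rho> con[OF Y]])
  note calc = third_order_calculus[OF N dG dH dT]
  have c1: "c * - (1 / \<beta>) = \<beta> powr (- p) / \<beta>\<^sup>2" and c2: "c * (1 / \<beta>)\<^sup>2 = - (\<beta> powr (- p) / \<beta> ^ 3)"
    using \<beta> by (simp_all add: c_def power2_eq_square power3_eq_cube)
  show thesis
  proof (rule that[OF calc(1-3) \<beta> e])
    show "\<beta> * (1 - e i) \<le> \<alpha>" if "X \<preceq>\<^sub>L \<alpha> *\<^sub>R id_symmat" for \<alpha> i
      using up[OF that] by (simp add: de)
    show "blinfun_apply (hessian f X) U \<bullet> U = (\<Sum>i\<in>UNIV. \<Sum>j\<in>UNIV.
      \<beta> powr (- p) / \<beta>\<^sup>2 * kernel2 (grad_coeff p) (e i) (e j) * (in_basis Q (mat_of U) $ i $ j)\<^sup>2)" for U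
    proof -
      have "blinfun_apply (hessian f X) U \<bullet> U
          = c * (dseries (grad_coeff p) (defect \<beta> X) (- (1 / \<beta>) *\<^sub>R mat_of U) \<bullet> mat_of U)"
        by (simp add: calc(4) H_def inner_sym_part)
      also have "\<dots> = c * (\<Sum>i\<in>UNIV. \<Sum>j\<in>UNIV. kernel2 (grad_coeff p) (e i) (e j)
          * (- (1 / \<beta>) * in_basis Q (mat_of U) $ i $ j) * in_basis Q (mat_of U) $ i $ j)"
        unfolding inner_in_basis[OF Q, symmetric, of "dseries _ _ _"]
        by (simp add: inner_vec_def in_basis_dseries[OF gc r Q E abs_e] in_basis_scaleR in_basis_neg)
      also have "\<dots> = (\<Sum>i\<in>UNIV. \<Sum>j\<in>UNIV.
          (c * - (1 / \<beta>)) * kernel2 (grad_coeff p) (e i) (e j) * (in_basis Q (mat_of U) $ i $ j)\<^sup>2)"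
        unfolding sum_distrib_left by (intro sum.cong refl) (simp add: power2_eq_square)
      finally show ?thesis unfolding c1 .
    qed
    show "blinfun_apply (third_deriv f X V) U \<bullet> U = - (\<Sum>i\<in>UNIV. \<Sum>l\<in>UNIV. (\<Sum>j\<in>UNIV.
      \<beta> powr (- p) / \<beta> ^ 3 * kernel3 (grad_coeff p) (e i) (e j) (e l)
        * (in_basis Q (mat_of V) $ i $ j * in_basis Q (mat_of U) $ j $ l
          + in_basis Q (mat_of U) $ i $ j * in_basis Q (mat_of V) $ j $ l))
        * in_basis Q (mat_of U) $ i $ l)" for V U
    proof -
      let ?v = "in_basis Q (mat_of V)" and ?u = "in_basis Q (mat_of U)"
      have "blinfun_apply (third_deriv f X V) U \<bullet> U
          = c * (ddseries (grad_coeff p) (defect \<beta> X) (- (1 / \<beta>) *\<^sub>R mat_of V) (- (1 / \<beta>) *\<^sub>R mat_of U) \<bullet> mat_of U)"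
        by (simp add: calc(5) T_def inner_sym_part)
      also have "\<dots> = c * (\<Sum>i\<in>UNIV. \<Sum>l\<in>UNIV. (\<Sum>j\<in>UNIV. kernel3 (grad_coeff p) (e i) (e j) (e l)
          * ((- (1 / \<beta>) * ?v $ i $ j) * (- (1 / \<beta>) * ?u $ j $ l)
            + (- (1 / \<beta>) * ?u $ i $ j) * (- (1 / \<beta>) * ?v $ j $ l))) * ?u $ i $ l)"
        unfolding inner_in_basis[OF Q, symmetric, of "ddseries _ _ _ _"]
        by (simp add: inner_vec_def in_basis_ddseries[OF gc r Q E abs_e] in_basis_scaleR in_basis_neg)
      also have "\<dots> = (\<Sum>i\<in>UNIV. \<Sum>l\<in>UNIV. (\<Sum>j\<in>UNIV. (c * (1 / \<beta>)\<^sup>2) * kernel3 (grad_coeff p) (e i) (e j) (e l)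
          * (?v $ i $ j * ?u $ j $ l + ?u $ i $ j * ?v $ j $ l)) * ?u $ i $ l)"
        unfolding sum_distrib_left sum_distrib_right
        by (intro sum.cong refl) (simp add: power2_eq_square algebra_simps)
      finally show ?thesis unfolding c2 by (simp add: sum_negf)
    qed
  qed
qed

text \<open>Restriction to segments reduces this to the second-derivative test in one
  variable.\<close>

lemma convex_on_hessian_nonneg:
  fixes f :: "'a::real_inner \<Rightarrow> real"
  assumes S: "convex S"
    and G: "\<And>x. x \<in> S \<Longrightarrow> GDERIV f x :> grad f x"
    and H: "\<And>x. x \<in> S \<Longrightarrow> (grad f has_derivative blinfun_apply (hessian f x)) (at x)"
    and nonneg: "\<And>x u. x \<in> S \<Longrightarrow> 0 \<le> blinfun_apply (hessian f x) u \<bullet> u"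
  shows "convex_on S f"
proof (rule convex_onI[OF _ S])
  fix x y :: 'a and t :: real
  assume xy: "x \<in> S" "y \<in> S" and t: "0 < t" "t < 1"
  define z where "z s = x + s *\<^sub>R (y - x)" for s
  have z: "z s \<in> S" if "s \<in> {0..1}" for s
    using convexD_alt[OF S xy, of s] that by (simp add: z_def algebra_simps)
  have dz: "(z has_derivative (\<lambda>s. s *\<^sub>R (y - x))) (at s)" for s
    unfolding z_def by (auto intro!: derivative_eq_intros)
  have "convex_on {0..1} (\<lambda>s. f (z s))"
  proof (rule f''_ge0_imp_convex)
    fix s :: real assume s: "s \<in> {0..1}"
    have "((\<lambda>s. f (z s)) has_derivative (\<lambda>h. (h *\<^sub>R (y - x)) \<bullet> grad f (z s))) (at s)"
      using has_derivative_compose[OF dz G[OF z[OF s], unfolded gderiv_def]] .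
    then show "((\<lambda>s. f (z s)) has_real_derivative (y - x) \<bullet> grad f (z s)) (at s)"
      by (rule has_derivative_imp_has_field_derivative) simp
    have "((\<lambda>s. (y - x) \<bullet> grad f (z s)) has_derivative
        (\<lambda>h. (y - x) \<bullet> blinfun_apply (hessian f (z s)) (h *\<^sub>R (y - x)))) (at s)"
      using has_derivative_inner_right[OF has_derivative_compose[OF dz H[OF z[OF s]]]] .
    then show "((\<lambda>s. (y - x) \<bullet> grad f (z s)) has_real_derivative
        (y - x) \<bullet> blinfun_apply (hessian f (z s)) (y - x)) (at s)"
      by (rule has_derivative_imp_has_field_derivative) (simp add: blinfun.scaleR_right)
    show "0 \<le> (y - x) \<bullet> blinfun_apply (hessian f (z s)) (y - x)"
      using nonneg[OF z[OF s], of "y - x"] by (simp add: inner_commute)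
  qed simp
  from convex_onD[OF this, of t 0 1] t
  have "f (z t) \<le> (1 - t) * f (z 0) + t * f (z 1)" by simp
  then show "f ((1 - t) *\<^sub>R x + t *\<^sub>R y) \<le> (1 - t) * f x + t * f y"
    by (simp add: z_def algebra_simps)
qed

theorem theorem4:
  fixes p \<alpha> :: real
  assumes "0 < p" and "0 < \<alpha>"
  shows "generalized_self_concordant
           (\<lambda>X :: 'n::finite symmat. trace (mat_powr X (- p)))
           pos_def_mats
           {X. 0 \<prec>\<^sub>L X \<and> X \<preceq>\<^sub>L \<alpha> *\<^sub>R id_symmat}
           ((p + 2) * root 4 (\<alpha> powr (2 * p) * real CARD('n)) / sqrt (p * (p + 1)))
           3"
proof -
  define f where "f = (\<lambda>X :: 'n symmat. trace (mat_powr X (- p)))"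
  define M where "M = (p + 2) * root 4 (\<alpha> powr (2 * p) * real CARD('n)) / sqrt (p * (p + 1))"
  \<comment> \<open>This is \<open>M\<close> with \<open>CARD('n)\<close> replaced by 1, as the
    fourth root of \<alpha> ^ (2 p) is \<alpha> ^ (p / 2). The pointwise kernel estimate produces
    \<open>M1\<close>, and at least one dimension gives \<open>M1 \<le> M\<close>.\<close>
  define M1 where "M1 = (p + 2) / sqrt (p * (p + 1)) * \<alpha> powr (p / 2)"
  have M1: "0 \<le> M1" using assms by (simp add: M1_def)
  have "\<alpha> powr (p / 2) = root 4 ((\<alpha> powr (p / 2)) ^ 4)" by (simp add: real_root_power_cancel)
  also have "(\<alpha> powr (p / 2)) ^ 4 = \<alpha> powr (2 * p)"
    using assms by (simp add: powr_power)
  also have "root 4 (\<alpha> powr (2 * p)) \<le> root 4 (\<alpha> powr (2 * p) * real CARD('n))"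
    by (simp add: mult_le_cancel_left1 Suc_leI)
  finally have "M1 \<le> M"
    unfolding M1_def M_def times_divide_eq_left[symmetric] using assms
    by (simp add: divide_right_mono mult_left_mono)
  have hess_nonneg: "0 \<le> blinfun_apply (hessian f X) U \<bullet> U" if X: "X \<in> pos_def_mats" for X U
  proof -
    obtain Q :: "real^'n^'n" and e :: "'n \<Rightarrow> real" and \<beta> :: real where
      \<beta>: "0 < \<beta>" and e: "\<And>i. 0 \<le> e i" "\<And>i. e i < 1"
      and H: "\<And>U. blinfun_apply (hessian f X) U \<bullet> U = (\<Sum>i\<in>UNIV. \<Sum>j\<in>UNIV.
        \<beta> powr (- p) / \<beta>\<^sup>2 * kernel2 (grad_coeff p) (e i) (e j) * (in_basis Q (mat_of U) $ i $ j)\<^sup>2)"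
      by (rule trace_power_calculus[OF assms(1) X, folded f_def]) blast
    show ?thesis
      unfolding H using \<beta> e by (intro sum_nonneg mult_nonneg_nonneg kernel2_grad_nonneg assms) auto
  qed
  have smooth: "GDERIV f X :> grad f X" "(grad f has_derivative blinfun_apply (hessian f X)) (at X)"
      "hessian f differentiable (at X)" if "X \<in> pos_def_mats" for X
    using trace_power_calculus[OF assms(1) that, folded f_def] by metis+
  have bound: "\<bar>blinfun_apply (third_deriv f X V) U \<bullet> U\<bar> \<le> M * (local_norm f X U)\<^sup>2 * local_norm f X V"
    if X: "0 \<prec>\<^sub>L X" "X \<preceq>\<^sub>L \<alpha> *\<^sub>R id_symmat" for X U V
  proof -
    have Xp: "X \<in> pos_def_mats" using X(1) by (simp add: pos_def_mats_def)
    obtain Q :: "real^'n^'n" and e :: "'n \<Rightarrow> real" and \<beta> :: real where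
      \<beta>: "0 < \<beta>" and e: "\<And>i. 0 \<le> e i" "\<And>i. e i < 1"
      and up: "\<And>i. \<beta> * (1 - e i) \<le> \<alpha>"
      and H: "\<And>U. blinfun_apply (hessian f X) U \<bullet> U = (\<Sum>i\<in>UNIV. \<Sum>j\<in>UNIV.
        \<beta> powr (- p) / \<beta>\<^sup>2 * kernel2 (grad_coeff p) (e i) (e j) * (in_basis Q (mat_of U) $ i $ j)\<^sup>2)"
      and T: "\<And>V U. blinfun_apply (third_deriv f X V) U \<bullet> U = - (\<Sum>i\<in>UNIV. \<Sum>l\<in>UNIV. (\<Sum>j\<in>UNIV.
        \<beta> powr (- p) / \<beta> ^ 3 * kernel3 (grad_coeff p) (e i) (e j) (e l)
          * (in_basis Q (mat_of V) $ i $ j * in_basis Q (mat_of U) $ j $ l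
            + in_basis Q (mat_of U) $ i $ j * in_basis Q (mat_of V) $ j $ l))
          * in_basis Q (mat_of U) $ i $ l)"
      by (rule trace_power_calculus[OF assms(1) Xp, folded f_def]) (use X(2) in blast)
    define K2 where "K2 i j = \<beta> powr (- p) / \<beta>\<^sup>2 * kernel2 (grad_coeff p) (e i) (e j)" for i j
    define K3 where "K3 i j l = \<beta> powr (- p) / \<beta> ^ 3 * kernel3 (grad_coeff p) (e i) (e j) (e l)" for i j l
    have K2: "0 \<le> K2 i j" for i j
      unfolding K2_def using \<beta> e by (intro mult_nonneg_nonneg kernel2_grad_nonneg assms) auto
    \<comment> \<open>Here \<open>K3\<close> is half of the overview's third-order kernel, since the
      two orders of V and U are summed separately; hence M1 / 2.\<close>
    have K3: "\<bar>K3 i j l\<bar> \<le> M1 / 2 * (sqrt (K2 i j) * sqrt (K2 j l) * sqrt (K2 i l))" for i j l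
    proof -
      let ?k2 = "kernel2 (grad_coeff p)" and ?k3 = "kernel3 (grad_coeff p) (e i) (e j) (e l)"
      \<comment> \<open>The lower bound is k = \<beta> / \<alpha>, because \<beta> (1 - e i) \<le>
        \<alpha>.\<close>
      have "(2 * ?k3)\<^sup>2 \<le> (p + 2)\<^sup>2 / (p * (p + 1)) * (\<beta> / \<alpha>) powr (- p)
          * (?k2 (e i) (e j) * ?k2 (e j) (e l) * ?k2 (e l) (e i))"
        by (rule kernel3_sq_le[OF assms(1)]) (use e \<beta> assms up in \<open>auto simp: field_simps\<close>)
      then have "(\<beta> powr (- p) / \<beta> ^ 3)\<^sup>2 * (2 * ?k3)\<^sup>2 \<le> (\<beta> powr (- p) / \<beta> ^ 3)\<^sup>2
          * ((p + 2)\<^sup>2 / (p * (p + 1)) * (\<beta> / \<alpha>) powr (- p)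
            * (?k2 (e i) (e j) * ?k2 (e j) (e l) * ?k2 (e l) (e i)))"
        by (intro mult_left_mono) auto
      \<comment> \<open>All powers of \<beta> cancel: the squared third-order prefactor times
        \<beta> ^ (- p) is the cube of the second-order one.\<close>
      also have "\<dots> = M1\<^sup>2 * (K2 i j * K2 j l * K2 l i)"
      proof -
        have "(\<alpha> powr (p / 2))\<^sup>2 = \<alpha> powr p" using assms by (simp add: powr_power)
        then have "M1\<^sup>2 = (p + 2)\<^sup>2 / (p * (p + 1)) * \<alpha> powr p"
          using assms by (simp add: M1_def power_mult_distrib power_divide)
        moreover have "(\<beta> / \<alpha>) powr (- p) = \<beta> powr (- p) * \<alpha> powr p"
          using \<beta> assms by (simp add: powr_divide powr_minus divide_simps)
        ultimately show ?thesis
          unfolding K2_def by (simp add: power2_eq_square power3_eq_cube mult_ac)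
      qed
      also have "\<dots> = (M1 * (sqrt (K2 i j) * sqrt (K2 j l) * sqrt (K2 i l)))\<^sup>2"
        using K2 by (simp add: power_mult_distrib K2_def kernel2_commute[of _ "e l" "e i"])
      finally have "(\<beta> powr (- p) / \<beta> ^ 3)\<^sup>2 * (2 * ?k3)\<^sup>2
          \<le> (M1 * (sqrt (K2 i j) * sqrt (K2 j l) * sqrt (K2 i l)))\<^sup>2" .
      moreover have "(\<beta> powr (- p) / \<beta> ^ 3)\<^sup>2 * (2 * ?k3)\<^sup>2 = (2 * K3 i j l)\<^sup>2"
        unfolding power_mult_distrib[symmetric] K3_def by (simp only: mult_ac)
      ultimately have "(2 * K3 i j l)\<^sup>2 \<le> (M1 * (sqrt (K2 i j) * sqrt (K2 j l) * sqrt (K2 i l)))\<^sup>2"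
        by simp
      then have "\<bar>2 * K3 i j l\<bar> \<le> M1 * (sqrt (K2 i j) * sqrt (K2 j l) * sqrt (K2 i l))"
        using M1 K2 by (subst (asm) abs_le_square_iff[symmetric]) (simp add: abs_mult)
      then show ?thesis by simp
    qed
    have ln: "(local_norm f X W)\<^sup>2 = (\<Sum>i\<in>UNIV. \<Sum>j\<in>UNIV. K2 i j * (in_basis Q (mat_of W) $ i $ j)\<^sup>2)" for W
      using hess_nonneg[OF Xp, of W] unfolding local_norm_def H K2_def by simp
    have ln0: "0 \<le> local_norm f X W" for W
      unfolding local_norm_def using hess_nonneg[OF Xp, of W] by simp
    have "\<bar>blinfun_apply (third_deriv f X V) U \<bullet> U\<bar>
        \<le> 2 * (M1 / 2) * (local_norm f X U)\<^sup>2 * sqrt ((local_norm f X V)\<^sup>2)"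
      unfolding T K3_def[symmetric] ln abs_minus_cancel
      by (rule weighted_trilinear_le[OF K2 K3]) (use M1 in simp)
    also have "\<dots> = M1 * (local_norm f X U)\<^sup>2 * local_norm f X V" using ln0 by simp
    also have "\<dots> \<le> M * (local_norm f X U)\<^sup>2 * local_norm f X V"
      using \<open>M1 \<le> M\<close> ln0 by (intro mult_right_mono) auto
    finally show ?thesis .
  qed
  have "generalized_self_concordant f pos_def_mats {X. 0 \<prec>\<^sub>L X \<and> X \<preceq>\<^sub>L \<alpha> *\<^sub>R id_symmat} M 3"
    unfolding generalized_self_concordant_def
  proof (intro conjI ballI allI)
    show "0 \<le> M" using M1 \<open>M1 \<le> M\<close> by simp
    show "convex_on pos_def_mats f"
      by (rule convex_on_hessian_nonneg[OF convex_pos_def_mats smooth(1,2) hess_nonneg])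
    show "three_times_differentiable_on f pos_def_mats"
      unfolding three_times_differentiable_on_def
      using smooth by (auto simp: gderiv_def differentiable_def)
    fix X :: "'n symmat" and U V
    assume "X \<in> {X. 0 \<prec>\<^sub>L X \<and> X \<preceq>\<^sub>L \<alpha> *\<^sub>R id_symmat}"
    then have X: "0 \<prec>\<^sub>L X" "X \<preceq>\<^sub>L \<alpha> *\<^sub>R id_symmat" by auto
    \<comment> \<open>Needed because \<open>t powr 1\<close> equals t only for t \<ge> 0; the power
      of \<open>norm V\<close> has exponent 0, where \<open>pow_real\<close> is 1.\<close>
    have "0 \<le> local_norm f X V"
      unfolding local_norm_def using hess_nonneg[of X V] X(1) by (simp add: pos_def_mats_def)
    then show "\<bar>blinfun_apply (third_deriv f X V) U \<bullet> U\<bar>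
        \<le> M * (local_norm f X U)\<^sup>2 * pow_real (local_norm f X V) (3 - 2) * pow_real (norm V) (3 - 3)"
      using bound[OF X, of V U] by (simp add: pow_real_def)
  qed (use open_pos_def_mats in \<open>auto simp: pos_def_mats_def\<close>)
  then show ?thesis unfolding f_def M_def .
qed

end
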